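(* Let $\lambda$ be regular, let $X, Y\in\mathscr{M}_\lambda$, and suppose that $Y$ is spherically complete. Let $1\le\xi<\lambda^+$ be either a successor ordinal or a limit ordinal of cofinality $\lambda$. Then \[\mathcal{M}_{\xi+1}(X,Y)=\lambda\text{-}\!\lim\mathcal{M}_\xi(X,Y).\] If $\xi$ is a limit ordinal, then moreover \[\mathcal{M}_{\xi+1}(X,Y)=\lambda\text{-}\!\lim\mathcal{M}_{<\xi}(X,Y).\]
   Context: Work in ZFC. $\lambda$ is an uncountable cardinal with $2^{<\lambda}=\lambda$; since $\lambda$ is regular, $\mu=\operatorname{cof}(\lambda)=\lambda$. All spaces are regular Hausdorff. $\mathbb{G}$ is a fixed ordered field with $\mathbb{G}^+$ of coinitiality $\lambda$; $\mathscr{M}_\lambda$ is the class of spaces of weight $\le\lambda$ whose topology is induced by a $\mathbb{G}$-valued metric. $Y$ is spherically complete if it admits a compatible $\mathbb{G}$-metric in which every decreasing sequence of closed balls has nonempty intersection. $\boldsymbol{\Sigma}^0_1(X)$ = open sets; for $1<\xi<\lambda^+$, $\boldsymbol{\Sigma}^0_\xi(X)$ = all unions $\bigcup_{i<\lambda}A_i$ with $X\setminus A_i\in\bigcup_{\xi'<\xi}\boldsymbol{\Sigma}^0_{\xi'}(X)$. $\mathcal{M}_\xi(X,Y)$ is the set of $f\colon X\to Y$ with $f^{-1}(U)\in\boldsymbol{\Sigma}^0_\xi(X)$ for all open $U$, and $\mathcal{M}_{<\xi}=\bigcup_{\xi'<\xi}\mathcal{M}_{\xi'}$. For a class $\mathcal{F}$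 of functions, $\lambda\text{-}\!\lim\mathcal{F}$ is the set of all pointwise limits $\lim_{\alpha<\lambda}f_\alpha$ (as nets indexed by the ordinal $\lambda$) with $f_\alpha\in\mathcal{F}$. *)

theory Defs
  imports "HOL-Analysis.Analysis"
begin

unbundle cardinal_syntax

section \<open>Ordinals as elements of a well-order\<close>

text \<open>
  A cardinal \<open>\<lambda>\<close> is a cardinal order relation \<open>lam\<close>; the ordinals below \<open>\<lambda>\<close> are the elements of
  \<open>Field lam\<close>, and the ordinals below \<open>\<lambda>\<^sup>+\<close> are the elements of \<open>Field (cardSuc lam)\<close>:
  an element \<open>a\<close> stands for the order type of \<open>underS r a\<close>.
\<close>

definition ozero :: "'a rel \<Rightarrow> 'a" where
  "ozero r = wo_rel.minim r (Field r)"

definition osuc :: "'a rel \<Rightarrow> 'a \<Rightarrow> 'a" where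
  "osuc r a = wo_rel.suc r {a}"

definition oone :: "'a rel \<Rightarrow> 'a" where
  "oone r = osuc r (ozero r)"

definition is_successor :: "'a rel \<Rightarrow> 'a \<Rightarrow> bool" where
  "is_successor r a \<longleftrightarrow> (\<exists>b\<in>Field r. a = osuc r b)"

definition is_limit :: "'a rel \<Rightarrow> 'a \<Rightarrow> bool" where
  "is_limit r a \<longleftrightarrow> a \<in> Field r \<and> a \<noteq> ozero r \<and> \<not> is_successor r a"

definition cofinal_below :: "'a rel \<Rightarrow> 'a \<Rightarrow> 'a set \<Rightarrow> bool" where
  "cofinal_below r a K \<longleftrightarrow> K \<subseteq> underS r a \<and> (\<forall>b\<in>underS r a. \<exists>c\<in>K. (b, c) \<in> r)"

definition has_cofinality :: "'a rel \<Rightarrow> 'a \<Rightarrow> 'l rel \<Rightarrow> bool" where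
  "has_cofinality r a lam \<longleftrightarrow>
     (\<exists>K. cofinal_below r a K \<and> |K| =o lam) \<and> (\<forall>K. cofinal_below r a K \<longrightarrow> lam \<le>o |K| )"

text \<open>
  \<open>2\<^bsup><\<lambda>\<^esup>\<close> is the cardinality of the set of binary sequences of length less than \<open>\<lambda>\<close>.  Each sequence
  is tagged with its length, since the extensional functions on different initial segments overlap.
\<close>

definition two_lt :: "'l rel \<Rightarrow> ('l \<times> ('l \<Rightarrow> bool)) rel" where
  "two_lt lam = |SIGMA a:Field lam. underS lam a \<rightarrow>\<^sub>E (UNIV :: bool set)|"


section \<open>Metrics with values in an ordered field\<close>

definition positive_coinitial :: "'g::linordered_field set \<Rightarrow> bool" where
  "positive_coinitial K \<longleftrightarrow> K \<subseteq> {0<..} \<and> (\<forall>e>0. \<exists>k\<in>K. k \<le> e)"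

definition has_coinitiality :: "'g::linordered_field itself \<Rightarrow> 'l rel \<Rightarrow> bool" where
  "has_coinitiality G lam \<longleftrightarrow>
     (\<exists>K :: 'g set. positive_coinitial K \<and> |K| =o lam) \<and>
     (\<forall>K :: 'g set. positive_coinitial K \<longrightarrow> lam \<le>o |K| )"

definition G_metric :: "'a set \<Rightarrow> ('a \<Rightarrow> 'a \<Rightarrow> 'g::linordered_field) \<Rightarrow> bool" where
  "G_metric S d \<longleftrightarrow>
     (\<forall>x\<in>S. \<forall>y\<in>S. 0 \<le> d x y \<and> (d x y = 0 \<longleftrightarrow> x = y) \<and> d x y = d y x) \<and>
     (\<forall>x\<in>S. \<forall>y\<in>S. \<forall>z\<in>S. d x z \<le> d x y + d y z)"

definition G_ball :: "'a set \<Rightarrow> ('a \<Rightarrow> 'a \<Rightarrow> 'g::linordered_field) \<Rightarrow> 'a \<Rightarrow> 'g \<Rightarrow> 'a set" where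
  "G_ball S d x r = {y \<in> S. d x y < r}"

definition G_cball :: "'a set \<Rightarrow> ('a \<Rightarrow> 'a \<Rightarrow> 'g::linordered_field) \<Rightarrow> 'a \<Rightarrow> 'g \<Rightarrow> 'a set" where
  "G_cball S d x r = {y \<in> S. d x y \<le> r}"

definition compatible_G_metric :: "'a topology \<Rightarrow> ('a \<Rightarrow> 'a \<Rightarrow> 'g::linordered_field) \<Rightarrow> bool" where
  "compatible_G_metric X d \<longleftrightarrow> G_metric (topspace X) d \<and>
     (\<forall>U. openin X U \<longleftrightarrow>
        U \<subseteq> topspace X \<and> (\<forall>x\<in>U. \<exists>r>0. G_ball (topspace X) d x r \<subseteq> U))"

definition weight_le :: "'a topology \<Rightarrow> 'l rel \<Rightarrow> bool" where
  "weight_le X lam \<longleftrightarrow>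
     (\<exists>\<B>. |\<B>| \<le>o lam \<and> (\<forall>V\<in>\<B>. openin X V) \<and>
          (\<forall>U x. openin X U \<and> x \<in> U \<longrightarrow> (\<exists>V\<in>\<B>. x \<in> V \<and> V \<subseteq> U)))"

definition M_class :: "'g::linordered_field itself \<Rightarrow> 'l rel \<Rightarrow> 'a topology \<Rightarrow> bool" where
  "M_class G lam X \<longleftrightarrow>
     regular_space X \<and> Hausdorff_space X \<and> weight_le X lam \<and>
     (\<exists>d :: 'a \<Rightarrow> 'a \<Rightarrow> 'g. compatible_G_metric X d)"

text \<open>
  The sequences have arbitrary (nonzero) ordinal length.  Indexing them by well-orders on
  \<^typ>\<open>'a set\<close> loses nothing: after deleting repetitions, a decreasing sequence of balls can be
  indexed by its own terms.
\<close>

definition spherically_complete_metric ::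
  "'a set \<Rightarrow> ('a \<Rightarrow> 'a \<Rightarrow> 'g::linordered_field) \<Rightarrow> bool" where
  "spherically_complete_metric S d \<longleftrightarrow>
     (\<forall>(s :: 'a set rel) c r.
        Well_order s \<and> Field s \<noteq> {} \<and> (\<forall>i\<in>Field s. c i \<in> S \<and> 0 < r i) \<and>
        (\<forall>i j. (i, j) \<in> s \<longrightarrow> G_cball S d (c j) (r j) \<subseteq> G_cball S d (c i) (r i))
        \<longrightarrow> (\<Inter>i\<in>Field s. G_cball S d (c i) (r i)) \<noteq> {})"

definition spherically_complete :: "'g::linordered_field itself \<Rightarrow> 'a topology \<Rightarrow> bool" where
  "spherically_complete G Y \<longleftrightarrow>
     (\<exists>d :: 'a \<Rightarrow> 'a \<Rightarrow> 'g. compatible_G_metric Y d \<and> spherically_complete_metric (topspace Y) d)"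


section \<open>The Borel hierarchy, measurable functions and pointwise limits\<close>

inductive Sigma0 :: "'l rel \<Rightarrow> 'a topology \<Rightarrow> 'l set \<Rightarrow> 'a set \<Rightarrow> bool"
  for lam :: "'l rel" and X :: "'a topology" where
  Sigma0_open: "openin X U \<Longrightarrow> Sigma0 lam X (oone (cardSuc lam)) U"
| Sigma0_union:
    "\<lbrakk>oone (cardSuc lam) \<in> underS (cardSuc lam) xi;
      \<forall>i\<in>Field lam. A i \<subseteq> topspace X \<and>
        (\<exists>eta\<in>underS (cardSuc lam) xi. Sigma0 lam X eta (topspace X - A i))\<rbrakk>
     \<Longrightarrow> Sigma0 lam X xi (\<Union>i\<in>Field lam. A i)"

text \<open>Functions between the carriers are represented extensionally.\<close>

definition meas_fun :: "'l rel \<Rightarrow> 'a topology \<Rightarrow> 'b topology \<Rightarrow> 'l set \<Rightarrow> ('a \<Rightarrow> 'b) set" where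
  "meas_fun lam X Y xi =
     {f \<in> topspace X \<rightarrow>\<^sub>E topspace Y.
        \<forall>U. openin Y U \<longrightarrow> Sigma0 lam X xi {x \<in> topspace X. f x \<in> U}}"

definition meas_fun_lt :: "'l rel \<Rightarrow> 'a topology \<Rightarrow> 'b topology \<Rightarrow> 'l set \<Rightarrow> ('a \<Rightarrow> 'b) set" where
  "meas_fun_lt lam X Y xi =
     (\<Union>eta\<in>{eta \<in> underS (cardSuc lam) xi. (oone (cardSuc lam), eta) \<in> cardSuc lam}.
        meas_fun lam X Y eta)"

definition tails :: "'l rel \<Rightarrow> 'l filter" where
  "tails lam = (INF a\<in>Field lam. principal {b \<in> Field lam. (a, b) \<in> lam})"

definition lam_lim ::
  "'l rel \<Rightarrow> 'a topology \<Rightarrow> 'b topology \<Rightarrow> ('a \<Rightarrow> 'b) set \<Rightarrow> ('a \<Rightarrow> 'b) set" where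
  "lam_lim lam X Y F =
     {f \<in> topspace X \<rightarrow>\<^sub>E topspace Y.
        \<exists>g. (\<forall>a\<in>Field lam. g a \<in> F) \<and>
            (\<forall>x\<in>topspace X. limitin Y (\<lambda>a. g a x) (f x) (tails lam))}"

end

theory Submission
  imports Defs
begin

text \<open>
  One inclusion writes \<open>f\<^sup>-\<^sup>1(C) = (\<Union>a. \<Inter>b\<ge>a. f\<^sub>b\<^sup>-\<^sup>1(C))\<close> for clopen \<open>C\<close>, using that \<open>Y\<close> has a base of
  clopen sets.

  For the other one, fix clopen partitions of \<open>Y\<close> at scales \<open>a < \<lambda>\<close>, refining as \<open>a\<close> grows. If \<open>f\<close> is
  \<open>\<Sigma>\<^sup>0\<^sub>\<xi>\<^sub>+\<^sub>1\<close>-measurable, then at scale \<open>a\<close> the space \<open>X\<close> is covered by sets \<open>\<Inter>j<\<lambda>. D a c j\<close>, \<open>c < \<lambda>\<close>, each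
  mapped by \<open>f\<close> into one class, where the \<open>D a c j\<close> are \<open>\<Delta>\<^sup>0\<close> sets of successor level at most \<open>\<xi>\<close>.
  The value \<open>f\<^sub>b(x)\<close> depends only on which \<open>D a c j\<close> with \<open>a, c, j < b\<close> contain \<open>x\<close>: at each scale
  \<open>a < b\<close> guess the class belonging to the least \<open>c < b\<close> not refuted by some \<open>j < b\<close>, and choose a
  point in all classes of the longest consistent run of guesses, which exists by spherical
  completeness. Since \<open>2\<^bsup><\<lambda>\<^esup> = \<lambda>\<close>, there are at most \<open>\<lambda>\<close> membership patterns, so \<open>f\<^sub>b\<close> is measurable at
  the common level of these fewer than \<open>\<lambda>\<close> sets; the hypothesis on \<open>\<xi>\<close> puts this level at \<open>\<xi>\<close> or, for
  limit \<open>\<xi>\<close>, below it. By regularity all guesses up to a given scale are correct for large \<open>b\<close>.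
\<close>

subsection \<open>Well-orders and regular cardinals\<close>

lemma wo_underS_iff:
  assumes "Well_order r" "a \<in> Field r" "b \<in> Field r"
  shows "b \<in> underS r a \<longleftrightarrow> (a, b) \<notin> r"
proof -
  interpret wo_rel r using assms by (simp add: wo_rel_def)
  show ?thesis
    using assms(2,3) TOTALS ANTISYM REFL
    unfolding underS_def by (auto simp: antisym_def refl_on_def)
qed

lemma wo_under_underS_trans:
  assumes "Well_order r" "(a, b) \<in> r" "b \<in> underS r c"
  shows "a \<in> underS r c"
proof -
  interpret wo_rel r using assms by (simp add: wo_rel_def)
  show ?thesis
    using assms(2,3) TRANS ANTISYM
    unfolding underS_def by (auto dest: transD antisymD)
qed

lemma wo_underS_under_trans:
  assumes "Well_order r" "a \<in> underS r b" "(b, c) \<in> r"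
  shows "a \<in> underS r c"
proof -
  interpret wo_rel r using assms by (simp add: wo_rel_def)
  show ?thesis
    using assms(2,3) TRANS ANTISYM
    unfolding underS_def by (auto dest: transD antisymD)
qed

section \<open>Successors in a well-order without a largest element\<close>

locale limit_wo = wo_rel r for r :: "'a rel" +
  assumes ne: "Field r \<noteq> {}"
    and no_max: "\<And>a. a \<in> Field r \<Longrightarrow> \<exists>b\<in>Field r. a \<noteq> b \<and> (a, b) \<in> r"
begin

text \<open>\<open>wo_rel.suc\<close> is the least strict upper bound, which is meaningful because
  no element is largest.\<close>

lemma AboveS_single_ne: "a \<in> Field r \<Longrightarrow> AboveS {a} \<noteq> {}"
  using no_max[of a] by (auto simp: AboveS_def)

lemma osuc_in: "a \<in> Field r \<Longrightarrow> osuc r a \<in> Field r"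
  unfolding osuc_def by (intro suc_inField AboveS_single_ne) auto

lemma less_osuc: "a \<in> Field r \<Longrightarrow> a \<in> underS (osuc r a)"
  unfolding osuc_def underS_def
  using suc_greater[OF _ AboveS_single_ne, of a a] by auto

lemma osuc_le: "a \<in> underS b \<Longrightarrow> (osuc r a, b) \<in> r"
  unfolding osuc_def
  by (intro suc_least_AboveS) (auto simp: AboveS_def underS_def Field_def)

lemma less_osuc_iff:
  assumes "a \<in> Field r"
  shows "b \<in> underS (osuc r a) \<longleftrightarrow> (b, a) \<in> r"
proof
  assume b: "b \<in> underS (osuc r a)"
  then have bF: "b \<in> Field r" using underS_Field by fast
  show "(b, a) \<in> r"
  proof (rule ccontr)
    assume "(b, a) \<notin> r"
    then have "a \<in> underS b" using wo_underS_iff[OF WELL bF assms] by simp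
    then have "(osuc r a, b) \<in> r" by (rule osuc_le)
    then show False using b ANTISYM unfolding underS_def by (auto dest: antisymD)
  qed
next
  assume "(b, a) \<in> r"
  then show "b \<in> underS (osuc r a)"
    using wo_under_underS_trans[OF WELL _ less_osuc[OF assms]] by blast
qed

lemma ozero_in: "ozero r \<in> Field r"
  unfolding ozero_def using minim_inField[OF subset_refl ne] .

lemma ozero_le: "b \<in> Field r \<Longrightarrow> (ozero r, b) \<in> r"
  unfolding ozero_def by (rule minim_least) auto

lemma oone_in: "oone r \<in> Field r"
  unfolding oone_def by (intro osuc_in ozero_in)

lemma oone_le_iff:
  assumes "b \<in> Field r"
  shows "(oone r, b) \<in> r \<longleftrightarrow> b \<noteq> ozero r"
proof
  assume "(oone r, b) \<in> r"
  then have "ozero r \<in> underS b"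
    unfolding oone_def
    using less_osuc[OF ozero_in] wo_underS_under_trans[OF WELL] by blast
  then show "b \<noteq> ozero r" by (auto simp: underS_def)
next
  assume "b \<noteq> ozero r"
  then have "ozero r \<in> underS b" using ozero_le[OF assms] by (auto simp: underS_def)
  then show "(oone r, b) \<in> r" unfolding oone_def by (rule osuc_le)
qed

lemma oone_le_osuc:
  assumes "b \<in> Field r"
  shows "(oone r, osuc r b) \<in> r"
proof -
  have "ozero r \<in> underS (osuc r b)" using assms less_osuc_iff ozero_le by blast
  then show ?thesis unfolding oone_def by (rule osuc_le)
qed

lemma le_or_less: "\<lbrakk>a \<in> Field r; b \<in> Field r\<rbrakk> \<Longrightarrow> (a, b) \<in> r \<or> b \<in> underS a"
  using wo_underS_iff[OF WELL] by blast

end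

section \<open>Cardinal arithmetic at and below a regular cardinal\<close>

locale regular_cardinal =
  fixes lam :: "'l rel"
  assumes card: "Card_order lam"
    and uncountable: "natLeq <o lam"
    and two_lt: "two_lt lam =o lam"
    and regular: "regularCard lam"
begin

abbreviation le1 :: "'l set \<Rightarrow> 'l set \<Rightarrow> bool" (infix \<open>\<sqsubseteq>\<close> 50) where
  "a \<sqsubseteq> b \<equiv> (a, b) \<in> cardSuc lam"

abbreviation lt1 :: "'l set \<Rightarrow> 'l set \<Rightarrow> bool" (infix \<open>\<sqsubset>\<close> 50) where
  "a \<sqsubset> b \<equiv> a \<in> underS (cardSuc lam) b"

abbreviation "one \<equiv> oone (cardSuc lam)"

abbreviation small :: "'b set \<Rightarrow> bool" where
  "small A \<equiv> |A| <o lam"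

abbreviation moderate :: "'b set \<Rightarrow> bool" where
  "moderate A \<equiv> |A| \<le>o lam"

lemma WO: "Well_order lam"
  using card by (simp add: card_order_on_def)

lemma infinite_Field: "infinite (Field lam)"
  using uncountable card
  by (meson cinfinite_def cinfinite_mono natLeq_cinfinite ordLess_imp_ordLeq)

lemma Cinf: "Cinfinite lam"
  using infinite_Field card by (simp add: cinfinite_def)

sublocale L: limit_wo lam
proof
  show "Well_order lam" by (rule WO)
  show "Field lam \<noteq> {}" using infinite_Field by auto
  show "\<exists>b\<in>Field lam. a \<noteq> b \<and> (a, b) \<in> lam" if "a \<in> Field lam" for a
    using infinite_Card_order_limit[OF card infinite_Field that] .
qed

sublocale S: limit_wo "cardSuc lam"
proof
  have C: "Cinfinite (cardSuc lam)" using Cinfinite_cardSuc[OF Cinf] .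
  show "Well_order (cardSuc lam)" using cardSuc_Well_order[OF card] .
  show "Field (cardSuc lam) \<noteq> {}" using C by (auto simp: cinfinite_def)
  show "\<exists>b\<in>Field (cardSuc lam). a \<noteq> b \<and> (a, b) \<in> cardSuc lam"
    if "a \<in> Field (cardSuc lam)" for a
    using infinite_Card_order_limit[of "cardSuc lam"] C that by (auto simp: cinfinite_def)
qed

lemma stab: "stable lam"
  using regularCard_stable[OF card infinite_Field regular] .

lemma moderate_Field: "moderate (Field lam)"
  using card_of_Field_ordIso[OF card] ordIso_imp_ordLeq by blast

lemma small_imp_moderate: "small A \<Longrightarrow> moderate A"
  by (rule ordLess_imp_ordLeq)

lemma moderate_mono: "A \<subseteq> B \<Longrightarrow> moderate B \<Longrightarrow> moderate A"
  using card_of_mono1 ordLeq_transitive by blast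

lemma small_mono: "A \<subseteq> B \<Longrightarrow> small B \<Longrightarrow> small A"
  using card_of_mono1 ordLeq_ordLess_trans by blast

lemma moderate_image: "moderate A \<Longrightarrow> moderate (f ` A)"
  using card_of_image ordLeq_transitive by blast

lemma small_image: "small A \<Longrightarrow> small (f ` A)"
  using card_of_image ordLeq_ordLess_trans by blast

lemma small_underS: "a \<in> Field lam \<Longrightarrow> small (underS lam a)"
  using card_of_underS[OF card] .

lemma under_subset_osuc: "a \<in> Field lam \<Longrightarrow> under lam a \<subseteq> underS lam (osuc lam a)"
  using L.less_osuc_iff by (auto simp: under_def)

lemma small_under: "a \<in> Field lam \<Longrightarrow> small (under lam a)"
  using small_mono[OF under_subset_osuc] small_underS L.osuc_in by blast

lemma moderate_UN: "moderate I \<Longrightarrow> (\<And>i. i \<in> I \<Longrightarrow> moderate (A i)) \<Longrightarrow> moderate (\<Union>i\<in>I. A i)"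
  using UNION_Cinfinite_bound[OF _ _ Cinf] by blast

lemma small_Sigma: "small I \<Longrightarrow> (\<And>i. i \<in> I \<Longrightarrow> small (A i)) \<Longrightarrow> small (SIGMA i:I. A i)"
  using stable_elim[OF stab] by blast

lemma small_UN: "small I \<Longrightarrow> (\<And>i. i \<in> I \<Longrightarrow> small (A i)) \<Longrightarrow> small (\<Union>i\<in>I. A i)"
  using stable_UNION[OF stab] by blast

lemma small_nat: "small (UNIV :: nat set)"
  using uncountable card_of_nat ordIso_ordLess_trans by blast

lemma small_insert: "small A \<Longrightarrow> small (insert x A)"
  using Un_Cinfinite_bound_strict[OF small_image[OF small_nat, of "\<lambda>_. x"] _ Cinf, of A] by simp

lemma moderate_insert: "moderate A \<Longrightarrow> moderate (insert x A)"
proof -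
  assume "moderate A"
  moreover have "moderate {x}"
    using card_of_singl_ordLeq[OF L.ne, of x] moderate_Field ordLeq_transitive by blast
  ultimately have "moderate ({x} \<union> A)" using Un_Cinfinite_bound Cinf by blast
  then show ?thesis by simp
qed

lemma moderate_enum:
  assumes "moderate A" "A \<noteq> {}"
  obtains e where "\<And>i. e i \<in> A" "e ` Field lam = A"
proof -
  have "|A| \<le>o |Field lam|"
    using assms(1) card_of_Field_ordIso[OF card] ordIso_symmetric ordLeq_ordIso_trans by blast
  then obtain g where g: "g ` Field lam = A"
    using card_of_ordLeq2[OF assms(2), of "Field lam"] by auto
  \<comment> \<open>\<open>a\<close> is the value outside \<open>Field lam\<close>, so that
    \<open>e i \<in> A\<close> holds for every index \<open>i\<close>.\<close>
  obtain a where a: "a \<in> A" using assms(2) by blast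
  show ?thesis
  proof
    show "(if i \<in> Field lam then g i else a) \<in> A" for i using g a by auto
    show "(\<lambda>i. if i \<in> Field lam then g i else a) ` Field lam = A" using g by auto
  qed
qed

text \<open>Regularity says that a small set is not cofinal; passing to the successor of the
  resulting bound makes it strict.\<close>

lemma small_bounded:
  assumes "A \<subseteq> Field lam" "small A"
  obtains b where "b \<in> Field lam" "A \<subseteq> underS lam b"
proof -
  have "\<not> cofinal A lam"
    using assms regular not_ordLess_ordIso unfolding regularCard_def by blast
  then obtain a where a: "a \<in> Field lam" "\<And>b. b \<in> A \<Longrightarrow> a = b \<or> (a, b) \<notin> lam"
    unfolding cofinal_def by blast
  have "A \<subseteq> under lam a"
  proof
    fix b assume b: "b \<in> A"
    then show "b \<in> under lam a"
      using a(2)[OF b] assms(1) a(1) L.TOTALS L.REFL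
      by (auto simp: under_def refl_on_def)
  qed
  then show ?thesis
    using that[OF L.osuc_in[OF a(1)]] under_subset_osuc[OF a(1)] by blast
qed

text \<open>This is where 2^{<lam} = lam enters: \<open>I\<close> is in bijection with a proper
  initial segment, so its subsets become binary sequences of a fixed length below
  \<open>lam\<close>.\<close>

lemma moderate_Pow:
  assumes "small I"
  shows "moderate (Pow I)"
proof -
  obtain a where a: "a \<in> Field lam" and iso: "|I| =o Restr lam (underS lam a)"
    using assms ordLess_iff_ordIso_Restr[OF WO card_of_Well_order] by blast
  have "Field (Restr lam (underS lam a)) = underS lam a"
    using Field_Restr_ofilter[OF WO] L.underS_ofilter by blast
  then obtain h where h: "bij_betw h I (underS lam a)"
    using iso Field_card_of[of I]
    unfolding ordIso_def iso_def by force
  define F where "F J = (a, \<lambda>b\<in>underS lam a. b \<in> h ` J)" for J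
  have "inj_on F (Pow I)"
  proof (rule inj_onI)
    fix J K assume JK: "J \<in> Pow I" "K \<in> Pow I" "F J = F K"
    have "h ` J = h ` K"
    proof -
      have "b \<in> h ` J \<longleftrightarrow> b \<in> h ` K" if "b \<in> underS lam a" for b
      proof -
        have "snd (F J) b = snd (F K) b" using JK(3) by simp
        then show ?thesis using that unfolding F_def by simp
      qed
      moreover have "h ` J \<subseteq> underS lam a" "h ` K \<subseteq> underS lam a"
        using JK h by (auto simp: bij_betw_def)
      ultimately show ?thesis by blast
    qed
    then show "J = K"
      using inj_on_image_eq_iff[of h I J K] h JK by (auto simp: bij_betw_def)
  qed
  moreover have "F ` Pow I \<subseteq> (SIGMA a:Field lam. underS lam a \<rightarrow>\<^sub>E (UNIV :: bool set))"
    using a by (auto simp: F_def)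
  ultimately have "|Pow I| \<le>o two_lt lam"
    unfolding two_lt_def using card_of_ordLeq by blast
  then show ?thesis using two_lt ordLeq_ordIso_trans by blast
qed

lemma eventually_tails:
  "eventually P (tails lam) \<longleftrightarrow> (\<exists>a\<in>Field lam. \<forall>b. (a, b) \<in> lam \<longrightarrow> P b)"
proof -
  have "eventually P (tails lam) \<longleftrightarrow>
    (\<exists>a\<in>Field lam. eventually P (principal {b \<in> Field lam. (a, b) \<in> lam}))"
    unfolding tails_def
  proof (rule eventually_INF_base[OF L.ne])
    fix a b assume ab: "a \<in> Field lam" "b \<in> Field lam"
    then obtain c where "c \<in> Field lam" "(a, c) \<in> lam" "(b, c) \<in> lam"
      using L.TOTALS L.REFL by (metis refl_onD)
    then show "\<exists>x\<in>Field lam. principal {b \<in> Field lam. (x, b) \<in> lam}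
        \<le> inf (principal {b \<in> Field lam. (a, b) \<in> lam}) (principal {c \<in> Field lam. (b, c) \<in> lam})"
      using L.TRANS by (intro bexI[of _ c]) (auto dest: transD)
  qed
  then show ?thesis by (auto simp: eventually_principal Field_def)
qed

end

subsection \<open>The Borel hierarchy of a metric space over an ordered field\<close>

locale G_metric_space = regular_cardinal lam
  for lam :: "'l rel" +
  fixes X :: "'a topology" and d :: "'a \<Rightarrow> 'a \<Rightarrow> 'g::linordered_field"
  assumes coinitiality: "has_coinitiality TYPE('g) lam"
    and metric: "compatible_G_metric X d"
    and weight: "weight_le X lam"
begin

lemma d_nonneg: "x \<in> topspace X \<Longrightarrow> y \<in> topspace X \<Longrightarrow> 0 \<le> d x y"
  and d_zero: "x \<in> topspace X \<Longrightarrow> y \<in> topspace X \<Longrightarrow> d x y = 0 \<longleftrightarrow> x = y"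
  and d_sym: "x \<in> topspace X \<Longrightarrow> y \<in> topspace X \<Longrightarrow> d x y = d y x"
  and d_triangle: "x \<in> topspace X \<Longrightarrow> y \<in> topspace X \<Longrightarrow> z \<in> topspace X \<Longrightarrow> d x z \<le> d x y + d y z"
  using metric unfolding compatible_G_metric_def G_metric_def by simp_all

lemma openin_iff:
  "openin X U \<longleftrightarrow> U \<subseteq> topspace X \<and>
     (\<forall>x\<in>U. \<exists>r>0. \<forall>y\<in>topspace X. d x y < r \<longrightarrow> y \<in> U)"
proof -
  have "G_ball (topspace X) d x r \<subseteq> U \<longleftrightarrow> (\<forall>y\<in>topspace X. d x y < r \<longrightarrow> y \<in> U)" for x r
    unfolding G_ball_def by blast
  then show ?thesis using metric unfolding compatible_G_metric_def by simp
qed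

text \<open>Fewer than \<open>lam\<close> positive elements cannot be coinitial in a field of
  coinitiality \<open>lam\<close>.\<close>

lemma small_lower_bound:
  fixes K :: "'g set"
  assumes "small K" "K \<subseteq> {0<..}"
  obtains e where "e > 0" "\<And>k. k \<in> K \<Longrightarrow> e < k"
proof -
  have "\<not> positive_coinitial K"
    using assms(1) coinitiality not_ordLess_ordLeq unfolding has_coinitiality_def by blast
  then show ?thesis
    using assms(2) that unfolding positive_coinitial_def by (meson not_le)
qed

text \<open>The radii belonging to one point are fewer than \<open>lam\<close>, so they have a
  common positive lower bound.\<close>

lemma openin_small_INT:
  assumes "small I" "\<And>i. i \<in> I \<Longrightarrow> openin X (U i)"
  shows "openin X (topspace X \<inter> (\<Inter>i\<in>I. U i))"
  unfolding openin_iff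
proof (intro conjI ballI)
  fix x assume x: "x \<in> topspace X \<inter> (\<Inter>i\<in>I. U i)"
  have "\<exists>r>0. \<forall>y\<in>topspace X. d x y < r \<longrightarrow> y \<in> U i" if "i \<in> I" for i
    using assms(2)[OF that] x that unfolding openin_iff by blast
  then obtain r where r: "\<And>i. i \<in> I \<Longrightarrow> r i > 0"
    "\<And>i y. i \<in> I \<Longrightarrow> y \<in> topspace X \<Longrightarrow> d x y < r i \<Longrightarrow> y \<in> U i"
    by metis
  obtain e where "e > 0" "\<And>k. k \<in> r ` I \<Longrightarrow> e < k"
    using small_lower_bound[OF small_image[OF assms(1)], of r] r(1) by blast
  then show "\<exists>r>0. \<forall>y\<in>topspace X. d x y < r \<longrightarrow> y \<in> topspace X \<inter> (\<Inter>i\<in>I. U i)"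
    using r(2) by (intro exI[of _ e]) force
qed auto

section \<open>Zero-dimensionality and the Lindelof property at \<open>lam\<close>\<close>

definition clopen :: "'a set \<Rightarrow> bool" where
  "clopen C \<longleftrightarrow> openin X C \<and> openin X (topspace X - C)"

text \<open>The neighbourhood consists of the points whose distance to \<open>x\<close> stays below
  \<open>r\<close> after multiplication by any positive integer. It is a countable intersection of
  open balls, hence open as \<open>lam\<close> is uncountable; quantifying over all multiples makes
  the complement open too.\<close>

lemma clopen_nbhd:
  assumes "openin X U" "x \<in> U"
  obtains C where "clopen C" "x \<in> C" "C \<subseteq> U"
proof -
  have xX: "x \<in> topspace X" using assms openin_subset by blast
  obtain r where r: "r > 0" "\<And>y. y \<in> topspace X \<Longrightarrow> d x y < r \<Longrightarrow> y \<in> U"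
    using assms unfolding openin_iff by blast
  define C where "C = {y \<in> topspace X. \<forall>n. of_nat (Suc n) * d x y < r}"
  have "openin X (topspace X \<inter> (\<Inter>n::nat. {y \<in> topspace X. of_nat (Suc n) * d x y < r}))"
  proof (rule openin_small_INT[OF small_nat])
    fix n :: nat
    show "openin X {y \<in> topspace X. of_nat (Suc n) * d x y < r}"
      unfolding openin_iff
    proof (intro conjI ballI)
      fix y assume y: "y \<in> {y \<in> topspace X. of_nat (Suc n) * d x y < r}"
      define e where "e = r / of_nat (Suc n) - d x y"
      have m: "(0::'g) < of_nat (Suc n)" by (simp del: of_nat_Suc)
      have e: "e > 0"
        using y pos_less_divide_eq[OF m] by (simp add: e_def mult.commute del: of_nat_Suc)
      have "of_nat (Suc n) * d x z < r" if "z \<in> topspace X" "d y z < e" for z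
      proof -
        have "d x z < r / of_nat (Suc n)"
          using d_triangle[OF xX _ that(1), of y] y that(2) unfolding e_def by auto
        then show ?thesis
          using pos_less_divide_eq[OF m] by (simp add: mult.commute del: of_nat_Suc)
      qed
      then show "\<exists>r'>0. \<forall>z\<in>topspace X. d y z < r' \<longrightarrow>
          z \<in> {y \<in> topspace X. of_nat (Suc n) * d x y < r}"
        using e by blast
    qed auto
  qed
  moreover have "topspace X \<inter> (\<Inter>n::nat. {y \<in> topspace X. of_nat (Suc n) * d x y < r}) = C"
    by (auto simp: C_def)
  ultimately have "openin X C" by simp
  moreover have "openin X (topspace X - C)"
    unfolding openin_iff
  proof (intro conjI ballI)
    fix y assume y: "y \<in> topspace X - C"
    then obtain n where n: "of_nat (Suc n) * d x y \<ge> r" by (auto simp: C_def not_less)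
    define e where "e = r / (2 * of_nat (Suc n))"
    have m: "(0::'g) < 2 * of_nat (Suc n)" by (simp del: of_nat_Suc)
    have e: "e > 0" unfolding e_def by (rule divide_pos_pos[OF r(1) m])
    have "z \<notin> C" if z: "z \<in> topspace X" "d y z < e" for z
    proof
      assume "z \<in> C"
      \<comment> \<open>The multiple \<open>2 * (n + 1)\<close> gives \<open>d x z < e\<close>;
        together with \<open>d y z < e\<close> the triangle inequality contradicts the choice of
        \<open>n\<close>.\<close>
      then have "of_nat (Suc (2 * n + 1)) * d x z < r" unfolding C_def by blast
      moreover have "of_nat (Suc (2 * n + 1)) = (2 * of_nat (Suc n) :: 'g)" by simp
      ultimately have "2 * of_nat (Suc n) * d x z < r" by metis
      then have "d x z < e"
        unfolding e_def pos_less_divide_eq[OF m] by (simp only: mult.commute)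
      moreover have "d x y \<le> d x z + d z y" "d z y = d y z"
        using d_triangle[of x z y] d_sym[of z y] xX z y by auto
      ultimately have "d x y < 2 * e" using z(2) by linarith
      moreover have "2 * e = r / of_nat (Suc n)" by (simp add: e_def del: of_nat_Suc)
      ultimately have "d x y * of_nat (Suc n) < r"
        using pos_less_divide_eq[of "of_nat (Suc n)" "d x y" r] by (simp del: of_nat_Suc)
      then show False using n by (simp add: mult.commute del: of_nat_Suc)
    qed
    then show "\<exists>r>0. \<forall>z\<in>topspace X. d y z < r \<longrightarrow> z \<in> topspace X - C"
      using e by blast
  qed auto
  moreover have "x \<in> C" using xX d_zero[OF xX xX] r(1) by (simp add: C_def)
  moreover have "C \<subseteq> U"
  proof
    fix y assume y: "y \<in> C"
    then have "of_nat (Suc 0) * d x y < r" unfolding C_def by blast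
    then show "y \<in> U" using r(2) y by (simp add: C_def)
  qed
  ultimately show ?thesis using that by (auto simp: clopen_def)
qed

text \<open>Every base set contained in some member of the family picks one such member; the picked
  members already cover, and the base has at most \<open>lam\<close> elements.\<close>

lemma Lindelof:
  assumes "\<And>U. U \<in> \<U> \<Longrightarrow> openin X U"
  obtains \<V> where "\<V> \<subseteq> \<U>" "moderate \<V>" "\<Union>\<V> = \<Union>\<U>"
proof -
  obtain \<B> where B: "moderate \<B>"
    "\<forall>U x. openin X U \<and> x \<in> U \<longrightarrow> (\<exists>V\<in>\<B>. x \<in> V \<and> V \<subseteq> U)"
    using weight unfolding weight_le_def by (elim exE conjE) (rule that)
  define \<C> where "\<C> = {V \<in> \<B>. \<exists>U\<in>\<U>. V \<subseteq> U}"
  have "\<forall>V\<in>\<C>. \<exists>U. U \<in> \<U> \<and> V \<subseteq> U" unfolding \<C>_def by blast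
  then obtain u where u: "\<And>V. V \<in> \<C> \<Longrightarrow> u V \<in> \<U> \<and> V \<subseteq> u V" by metis
  show ?thesis
  proof
    show sub: "u ` \<C> \<subseteq> \<U>" using u by blast
    show "moderate (u ` \<C>)"
      by (rule moderate_image, rule moderate_mono[OF _ B(1)]) (auto simp: \<C>_def)
    have "x \<in> \<Union>(u ` \<C>)" if xU: "x \<in> U" "U \<in> \<U>" for x U
    proof -
      obtain V where "V \<in> \<B>" "x \<in> V" "V \<subseteq> U" using B(2) assms[OF xU(2)] xU(1) by blast
      then show ?thesis using u[of V] xU unfolding \<C>_def by blast
    qed
    then show "\<Union>(u ` \<C>) = \<Union>\<U>" using sub by blast
  qed
qed

lemma open_clopen_union:
  assumes "openin X U"
  obtains \<C> where "moderate \<C>" "\<And>C. C \<in> \<C> \<Longrightarrow> clopen C" "\<Union>\<C> = U"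
proof -
  obtain \<C> where C: "\<C> \<subseteq> {C. clopen C \<and> C \<subseteq> U}" "moderate \<C>" "\<Union>\<C> = \<Union>{C. clopen C \<and> C \<subseteq> U}"
    using Lindelof[of "{C. clopen C \<and> C \<subseteq> U}"] by (auto simp: clopen_def)
  moreover have "\<Union>{C. clopen C \<and> C \<subseteq> U} = U"
    using clopen_nbhd[OF assms] by blast
  ultimately show ?thesis using that[of \<C>] by auto
qed

section \<open>Closure properties of the levels of the hierarchy\<close>

abbreviation "Sig \<equiv> Sigma0 lam X"

lemma Sigma0_level: "Sig xi U \<Longrightarrow> one \<sqsubseteq> xi"
  by (induction rule: Sigma0.induct) (use S.oone_in S.REFL in \<open>auto simp: refl_on_def underS_def\<close>)

lemma Sigma0_one: "Sig one U \<longleftrightarrow> openin X U"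
proof
  assume "Sig one U"
  then show "openin X U" by cases (auto simp: underS_def)
qed (rule Sigma0_open)

text \<open>Trades enumerations along \<open>Field lam\<close> for families of at most
  \<open>lam\<close> sets, which are easier to combine and may be empty.\<close>

lemma Sigma0_gt_one:
  assumes "one \<sqsubset> xi"
  shows "Sig xi U \<longleftrightarrow> (\<exists>\<F>. moderate \<F> \<and> U = \<Union>\<F> \<and>
    (\<forall>A\<in>\<F>. A \<subseteq> topspace X \<and> (\<exists>eta. eta \<sqsubset> xi \<and> Sig eta (topspace X - A))))"
    (is "_ \<longleftrightarrow> (\<exists>\<F>. ?P \<F>)")
proof
  assume "Sig xi U"
  then show "\<exists>\<F>. ?P \<F>"
  proof cases
    case Sigma0_open
    then show ?thesis using assms by (auto simp: underS_def)
  next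
    case (Sigma0_union A)
    then have "?P (A ` Field lam)" using moderate_image[OF moderate_Field, of A] by blast
    then show ?thesis by blast
  qed
next
  assume "\<exists>\<F>. ?P \<F>"
  then obtain \<F> where F: "?P \<F>" ..
  \<comment> \<open>Adding the empty set guarantees an enumeration; its complement is open, hence at
    level \<open>one\<close>, which is below \<open>xi\<close>.\<close>
  have "moderate (insert {} \<F>)" using F by (simp add: moderate_insert)
  from moderate_enum[OF this insert_not_empty]
  obtain e where e: "e ` Field lam = insert {} \<F>" by metis
  have "\<exists>eta\<in>underS (cardSuc lam) xi. Sig eta (topspace X - {})"
    using assms by (intro bexI[of _ one]) (auto simp: Sigma0_one)
  then have "\<forall>A\<in>insert {} \<F>. A \<subseteq> topspace X \<and>
      (\<exists>eta\<in>underS (cardSuc lam) xi. Sig eta (topspace X - A))"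
    using F by (simp add: Bex_def)
  then have "\<forall>i\<in>Field lam. e i \<subseteq> topspace X \<and>
      (\<exists>eta\<in>underS (cardSuc lam) xi. Sig eta (topspace X - e i))"
    unfolding e[symmetric] by blast
  then have "Sig xi (\<Union>i\<in>Field lam. e i)" by (rule Sigma0_union[OF assms])
  then show "Sig xi U" using F e by simp
qed

lemma Pi_imp_Sigma:
  assumes "Sig eta (topspace X - A)" "A \<subseteq> topspace X" "eta \<sqsubset> xi"
  shows "Sig xi A"
proof -
  have "one \<sqsubset> xi" using Sigma0_level[OF assms(1)] assms(3) wo_under_underS_trans[OF S.WELL] by blast
  moreover have "moderate {A}" using moderate_insert[OF card_of_empty1[OF disjI1[OF WO]]] .
  ultimately show ?thesis using assms by (subst Sigma0_gt_one) (auto intro!: exI[of _ "{A}"])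
qed

text \<open>Above level \<open>one\<close> the constituents of the union are reused. Level
  \<open>one\<close> is generated by a different rule, so there an open set is rewritten as a union
  of at most \<open>lam\<close> clopen sets, whose complements are open.\<close>

lemma Sigma0_mono:
  assumes "Sig eta U" "eta \<sqsubseteq> xi"
  shows "Sig xi U"
proof (cases "eta = xi")
  case False
  then have lt: "eta \<sqsubset> xi" using assms(2) by (auto simp: underS_def)
  have one: "one \<sqsubseteq> eta" using Sigma0_level[OF assms(1)] .
  then have gt: "one \<sqsubset> xi" using lt wo_under_underS_trans[OF S.WELL] by blast
  show ?thesis
  proof (cases "eta = one")
    case True
    then have "openin X U" using assms(1) Sigma0_one by simp
    then obtain \<C> where "moderate \<C>" "\<And>C. C \<in> \<C> \<Longrightarrow> clopen C" "\<Union>\<C> = U"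
      using open_clopen_union by blast
    then show ?thesis
      using gt unfolding Sigma0_gt_one[OF gt]
      by (intro exI[of _ \<C>]) (auto simp: clopen_def Sigma0_one dest: openin_subset intro!: exI[of _ one])
  next
    case False
    then have "one \<sqsubset> eta" using one by (auto simp: underS_def)
    then obtain \<F> where "moderate \<F>" "U = \<Union>\<F>"
      "\<forall>A\<in>\<F>. A \<subseteq> topspace X \<and> (\<exists>zeta. zeta \<sqsubset> eta \<and> Sig zeta (topspace X - A))"
      using assms(1) unfolding Sigma0_gt_one[OF \<open>one \<sqsubset> eta\<close>] by blast
    then show ?thesis
      using wo_underS_under_trans[OF S.WELL _ assms(2)]
      unfolding Sigma0_gt_one[OF gt] by (intro exI[of _ \<F>]) blast
  qed
qed (use assms in simp)

lemma Sigma0_Union: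
  assumes "moderate I" "\<And>i. i \<in> I \<Longrightarrow> Sig xi (U i)" "one \<sqsubseteq> xi"
  shows "Sig xi (\<Union>i\<in>I. U i)"
proof (cases "xi = one")
  case True
  then show ?thesis using assms by (auto simp: Sigma0_one)
next
  case False
  then have gt: "one \<sqsubset> xi" using assms(3) by (auto simp: underS_def)
  obtain F where F: "\<And>i. i \<in> I \<Longrightarrow> moderate (F i) \<and> U i = \<Union>(F i) \<and>
    (\<forall>A\<in>F i. A \<subseteq> topspace X \<and> (\<exists>eta. eta \<sqsubset> xi \<and> Sig eta (topspace X - A)))"
    using assms(2) unfolding Sigma0_gt_one[OF gt] by metis
  have "moderate (\<Union>i\<in>I. F i)" using moderate_UN[OF assms(1)] F by blast
  then show ?thesis
    unfolding Sigma0_gt_one[OF gt] using F by (intro exI[of _ "\<Union>i\<in>I. F i"]) auto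
qed

text \<open>By monotonicity every level below the successor of \<open>xi\<close> can be raised to
  \<open>xi\<close> itself.\<close>

lemma Sigma0_succ:
  assumes "one \<sqsubseteq> xi"
  shows "Sig (osuc (cardSuc lam) xi) U \<longleftrightarrow> (\<exists>\<F>. moderate \<F> \<and> U = \<Union>\<F> \<and>
    (\<forall>A\<in>\<F>. A \<subseteq> topspace X \<and> Sig xi (topspace X - A)))"
proof -
  have F: "xi \<in> Field (cardSuc lam)" using assms by (auto simp: Field_def)
  have lt: "xi \<sqsubset> osuc (cardSuc lam) xi" using S.less_osuc[OF F] .
  have gt: "one \<sqsubset> osuc (cardSuc lam) xi" using wo_under_underS_trans[OF S.WELL assms lt] .
  have "(\<exists>eta. eta \<sqsubset> osuc (cardSuc lam) xi \<and> Sig eta B) \<longleftrightarrow> Sig xi B" for B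
    using lt Sigma0_mono unfolding S.less_osuc_iff[OF F] by blast
  then show ?thesis unfolding Sigma0_gt_one[OF gt] by simp
qed

text \<open>The small intersection of unions is distributed over small subsets of \<open>J \<times> \<lambda>\<close>: by
  regularity the indices chosen for a given point are bounded, so there are only \<open>\<lambda>\<close> subsets to
  consider.\<close>

lemma Sigma0_small_INT:
  assumes "is_successor (cardSuc lam) xi" "small J" "\<And>j. j \<in> J \<Longrightarrow> Sig xi (U j)"
  shows "Sig xi (topspace X \<inter> (\<Inter>j\<in>J. U j))"
proof -
  obtain b where b: "b \<in> Field (cardSuc lam)" "xi = osuc (cardSuc lam) b"
    using assms(1) unfolding is_successor_def by blast
  show ?thesis
  \<comment> \<open>The successor of zero is level \<open>one\<close>, where the claim concerns open
    sets; otherwise the predecessor \<open>b\<close> is itself a level of the hierarchy.\<close>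
  proof (cases "b = ozero (cardSuc lam)")
    case True
    then have "xi = one" using b by (simp add: oone_def)
    then show ?thesis using assms openin_small_INT[OF assms(2)] by (simp add: Sigma0_one)
  next
    case False
    then have one: "one \<sqsubseteq> b" using S.oone_le_iff[OF b(1)] by simp
    have "\<exists>e. U j = \<Union>(e ` Field lam) \<and> (\<forall>i. e i \<subseteq> topspace X \<and> Sig b (topspace X - e i))"
      if j: "j \<in> J" for j
    proof -
      obtain \<F> where F: "moderate \<F>" "U j = \<Union>\<F>"
        "\<forall>A\<in>\<F>. A \<subseteq> topspace X \<and> Sig b (topspace X - A)"
        using assms(3)[OF j] unfolding b(2) Sigma0_succ[OF one] by (elim exE conjE) (rule that)
      have "Sig b (topspace X)" using Sigma0_mono[OF _ one] Sigma0_one openin_topspace by metis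
      then have F': "\<forall>A\<in>insert {} \<F>. A \<subseteq> topspace X \<and> Sig b (topspace X - A)" using F by simp
      obtain e where e: "\<And>i. e i \<in> insert {} \<F>" "e ` Field lam = insert {} \<F>"
        using moderate_enum[OF moderate_insert[OF F(1)] insert_not_empty] by metis
      then have "\<Union>(e ` Field lam) = U j" using F(2) by simp
      moreover have "e i \<subseteq> topspace X \<and> Sig b (topspace X - e i)" for i using F' e(1)[of i] by blast
      ultimately show ?thesis by metis
    qed
    then obtain e where e: "\<And>j. j \<in> J \<Longrightarrow> U j = \<Union>(e j ` Field lam)"
      "\<And>j i. j \<in> J \<Longrightarrow> e j i \<subseteq> topspace X \<and> Sig b (topspace X - e j i)" by metis
    \<comment> \<open>An \<open>S\<close> in \<open>\<S>\<close> selects at least one constituent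
      for every \<open>j\<close>. Extra pairs only shrink \<open>T S\<close>, so uniqueness of the
      choice is not encoded.\<close>
    define \<S> where "\<S> = {S \<in> (\<Union>c\<in>Field lam. Pow (J \<times> underS lam c)). J \<subseteq> fst ` S}"
    define T where "T S = topspace X \<inter> (\<Inter>p\<in>S. e (fst p) (snd p))" for S
    have "moderate (\<Union>c\<in>Field lam. Pow (J \<times> underS lam c))"
      by (intro moderate_UN moderate_Field moderate_Pow small_Sigma assms small_underS)
    then have mS: "moderate \<S>" by (rule moderate_mono[rotated]) (auto simp: \<S>_def)
    have eq: "topspace X \<inter> (\<Inter>j\<in>J. U j) = \<Union>(T ` \<S>)"
    proof (intro equalityI subsetI)
      fix x assume x: "x \<in> topspace X \<inter> (\<Inter>j\<in>J. U j)"
      then have "\<forall>j\<in>J. \<exists>i\<in>Field lam. x \<in> e j i" using e(1) by blast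
      then obtain s where s: "\<And>j. j \<in> J \<Longrightarrow> s j \<in> Field lam \<and> x \<in> e j (s j)" by metis
      obtain c where c: "c \<in> Field lam" "s ` J \<subseteq> underS lam c"
        using small_bounded[OF image_subsetI small_image[OF assms(2)], of s] s by metis
      have "(\<lambda>j. (j, s j)) ` J \<in> \<S>"
        unfolding \<S>_def using c by (force simp: image_image)
      moreover have "x \<in> T ((\<lambda>j. (j, s j)) ` J)" using x s by (auto simp: T_def)
      ultimately show "x \<in> \<Union>(T ` \<S>)" by blast
    next
      fix x assume "x \<in> \<Union>(T ` \<S>)"
      then obtain S where S: "S \<in> \<S>" "x \<in> T S" by blast
      have "x \<in> U j" if j: "j \<in> J" for j
      proof -
        obtain c i where "(j, i) \<in> S" "i \<in> underS lam c" using S(1) j unfolding \<S>_def by force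
        then have "x \<in> e j i" "i \<in> Field lam" using S(2) underS_Field by (force simp: T_def)+
        then show ?thesis using e(1)[OF j] by blast
      qed
      then show "x \<in> topspace X \<inter> (\<Inter>j\<in>J. U j)" using S(2) by (auto simp: T_def)
    qed
    \<comment> \<open>By De Morgan the complement of \<open>T S\<close> is a union of at most
      \<open>lam\<close> sets of level \<open>b\<close>, so \<open>T S\<close> may serve as a
      constituent one level up.\<close>
    have "Sig b (topspace X - T S)" if S: "S \<in> \<S>" for S
    proof -
      obtain c where c: "c \<in> Field lam" "S \<subseteq> J \<times> underS lam c" using S unfolding \<S>_def by blast
      have "small (J \<times> underS lam c)" by (intro small_Sigma assms small_underS c)
      then have "moderate S" using small_imp_moderate small_mono[OF c(2)] by blast
      then have "Sig b (\<Union>p\<in>S. topspace X - e (fst p) (snd p))"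
        using Sigma0_Union[of S b "\<lambda>p. topspace X - e (fst p) (snd p)"] one e(2) c(2) by force
      moreover have "(\<Union>p\<in>S. topspace X - e (fst p) (snd p)) = topspace X - T S"
        by (auto simp: T_def)
      ultimately show ?thesis by simp
    qed
    then show ?thesis
      unfolding b(2) Sigma0_succ[OF one] eq
      by (intro exI[of _ "T ` \<S>"]) (auto simp: moderate_image[OF mS] T_def)
  qed
qed

section \<open>Ambiguous sets and patterns of membership\<close>

definition Delta :: "'l set \<Rightarrow> 'a set \<Rightarrow> bool" where
  "Delta xi A \<longleftrightarrow> A \<subseteq> topspace X \<and> Sig xi A \<and> Sig xi (topspace X - A)"

lemma Delta_mono: "Delta eta A \<Longrightarrow> eta \<sqsubseteq> xi \<Longrightarrow> Delta xi A"
  by (auto simp: Delta_def intro: Sigma0_mono)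

text \<open>The pattern takes at most \<open>lam\<close> values by \<open>moderate_Pow\<close>, and
  the points realising a given value form a small intersection of sets \<open>D t\<close> and
  complements. So any condition read off the pattern alone is of level \<open>xi\<close>, whatever
  \<open>P\<close> is.\<close>

lemma signature_preimage:
  assumes "is_successor (cardSuc lam) xi" "small I" "\<And>t. t \<in> I \<Longrightarrow> Delta xi (D t)"
  shows "Sig xi {x \<in> topspace X. P {t \<in> I. x \<in> D t}}"
proof -
  define fib where
    "fib S = topspace X \<inter> (\<Inter>t\<in>I. if t \<in> S then D t else topspace X - D t)" for S
  have "Sig xi (fib S)" for S
    unfolding fib_def using assms(3)
    by (intro Sigma0_small_INT[OF assms(1,2)]) (auto simp: Delta_def)
  moreover have "moderate {S \<in> Pow I. P S}"
    by (rule moderate_mono[OF _ moderate_Pow[OF assms(2)]]) blast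
  moreover have "one \<sqsubseteq> xi"
    using assms(1) S.oone_le_osuc unfolding is_successor_def by blast
  ultimately have "Sig xi (\<Union>S\<in>{S \<in> Pow I. P S}. fib S)" by (intro Sigma0_Union)
  moreover have "{x \<in> topspace X. P {t \<in> I. x \<in> D t}} = (\<Union>S\<in>{S \<in> Pow I. P S}. fib S)"
  proof (intro equalityI subsetI)
    fix x assume "x \<in> {x \<in> topspace X. P {t \<in> I. x \<in> D t}}"
    then show "x \<in> (\<Union>S\<in>{S \<in> Pow I. P S}. fib S)"
      by (intro UN_I[of "{t \<in> I. x \<in> D t}"]) (auto simp: fib_def)
  next
    fix x assume "x \<in> (\<Union>S\<in>{S \<in> Pow I. P S}. fib S)"
    then obtain S where S: "S \<subseteq> I" "P S" "x \<in> fib S" by blast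
    then have "{t \<in> I. x \<in> D t} = S" by (auto simp: fib_def split: if_splits)
    then show "x \<in> {x \<in> topspace X. P {t \<in> I. x \<in> D t}}" using S by (auto simp: fib_def)
  qed
  ultimately show ?thesis by simp
qed

end

subsection \<open>Clopen partitions and spherical completeness\<close>

text \<open>\<open>k\<close> lists a coinitial set of positive scales along \<open>lam\<close>, not
  necessarily decreasingly; closeness at scale \<open>a\<close> therefore refers to all scales up to
  \<open>a\<close>.\<close>

locale spherical_space = G_metric_space lam X d
  for lam :: "'l rel" and X :: "'a topology" and d :: "'a \<Rightarrow> 'a \<Rightarrow> 'g::linordered_field" +
  fixes k :: "'l \<Rightarrow> 'g"
  assumes spherical: "spherically_complete_metric (topspace X) d"
    and k_pos: "\<And>a. a \<in> Field lam \<Longrightarrow> 0 < k a"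
    and k_coinitial: "\<And>e. 0 < e \<Longrightarrow> \<exists>a\<in>Field lam. k a \<le> e"
begin

text \<open>The factor \<open>n\<close> makes \<open>near a\<close> an equivalence relation; its classes are open since \<open>\<lambda>\<close> is
  regular and uncountable.\<close>

definition near :: "'l \<Rightarrow> 'a \<Rightarrow> 'a \<Rightarrow> bool" where
  "near a y z \<longleftrightarrow> (\<forall>b\<in>under lam a. \<forall>n. of_nat (Suc n) * d y z < k b)"

definition cls :: "'l \<Rightarrow> 'a \<Rightarrow> 'a set" where
  "cls a y = {z \<in> topspace X. near a y z}"

lemma under_in_Field: "b \<in> under lam a \<Longrightarrow> b \<in> Field lam"
  by (auto simp: under_def Field_def)

lemma self_under: "a \<in> Field lam \<Longrightarrow> a \<in> under lam a"
  using L.REFL by (auto simp: under_def refl_on_def)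

lemma under_mono: "(a, b) \<in> lam \<Longrightarrow> under lam a \<subseteq> under lam b"
  using L.TRANS by (auto simp: under_def dest: transD)

lemma near_mono:
  assumes "near a y z" "d y w \<le> d y z"
  shows "near a y w"
  unfolding near_def
proof (intro ballI allI)
  fix b n assume "b \<in> under lam a"
  then have "of_nat (Suc n) * d y z < k b" using assms(1) unfolding near_def by blast
  moreover have "of_nat (Suc n) * d y w \<le> of_nat (Suc n) * d y z"
    using assms(2) by (intro mult_left_mono) (auto simp del: of_nat_Suc)
  ultimately show "of_nat (Suc n) * d y w < k b" by (rule le_less_trans[rotated])
qed

lemma near_trans:
  assumes "near a x y" "near a y z" "x \<in> topspace X" "y \<in> topspace X" "z \<in> topspace X"
  shows "near a x z"
  unfolding near_def
proof (intro ballI allI)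
  fix b n assume b: "b \<in> under lam a"
  \<comment> \<open>Taking the multiple \<open>2 * (n + 1)\<close> for both summands leaves each of
    them below half of \<open>k b\<close>.\<close>
  have eq: "of_nat (Suc (2 * n + 1)) = (2 * of_nat (Suc n) :: 'g)" by simp
  have "2 * of_nat (Suc n) * d x y < k b" "2 * of_nat (Suc n) * d y z < k b"
    using assms(1,2) b unfolding near_def eq[symmetric] by blast+
  moreover have "of_nat (Suc n) * d x z \<le> of_nat (Suc n) * (d x y + d y z)"
    using d_triangle[OF assms(3-5)] by (intro mult_left_mono) (auto simp del: of_nat_Suc)
  moreover have "of_nat (Suc n) * (d x y + d y z) = of_nat (Suc n) * d x y + of_nat (Suc n) * d y z"
    by (rule distrib_left)
  ultimately show "of_nat (Suc n) * d x z < k b"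
    unfolding mult.assoc by linarith
qed

lemma near_sym: "near a x y \<Longrightarrow> x \<in> topspace X \<Longrightarrow> y \<in> topspace X \<Longrightarrow> near a y x"
  unfolding near_def using d_sym[of x y] by simp

lemma cls_self: "y \<in> topspace X \<Longrightarrow> y \<in> cls a y"
  using d_zero[of y y] k_pos[OF under_in_Field] by (simp add: cls_def near_def)

lemma cls_subset: "cls a y \<subseteq> topspace X"
  by (auto simp: cls_def)

lemma cls_eq:
  assumes "z \<in> cls a y" "y \<in> topspace X"
  shows "cls a z = cls a y"
proof -
  have "z \<in> topspace X" "near a y z" "near a z y" using assms near_sym by (auto simp: cls_def)
  then show ?thesis using assms(2) near_trans unfolding cls_def by blast
qed

lemma cls_anti: "(a, b) \<in> lam \<Longrightarrow> cls b y \<subseteq> cls a y"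
  using under_mono unfolding cls_def near_def by blast

lemma openin_cls:
  assumes "a \<in> Field lam" "y \<in> topspace X"
  shows "openin X (cls a y)"
  unfolding openin_iff
proof (intro conjI ballI cls_subset)
  fix z assume z: "z \<in> cls a y"
  \<comment> \<open>The conditions defining \<open>near a\<close> amount to fewer than
    \<open>lam\<close> radii \<open>k b / (n + 1)\<close>, so a single \<open>e\<close> lies below
    all of them.\<close>
  have "small (\<Union>b\<in>under lam a. range (\<lambda>n::nat. k b / of_nat (Suc n)))"
    by (intro small_UN small_under assms small_image small_nat)
  moreover have "(\<Union>b\<in>under lam a. range (\<lambda>n::nat. k b / of_nat (Suc n))) \<subseteq> {0<..}"
    using k_pos[OF under_in_Field] by (auto intro!: divide_pos_pos simp del: of_nat_Suc)
  ultimately obtain e where e: "e > 0"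
    "\<And>r. r \<in> (\<Union>b\<in>under lam a. range (\<lambda>n::nat. k b / of_nat (Suc n))) \<Longrightarrow> e < r"
    using small_lower_bound by metis
  have "w \<in> cls a y" if w: "w \<in> topspace X" "d z w < e" for w
  proof -
    have "near a z w"
      unfolding near_def
    proof (intro ballI allI)
      fix b n assume "b \<in> under lam a"
      then have "d z w < k b / of_nat (Suc n)" using e(2) w(2) by (blast intro: less_trans)
      then show "of_nat (Suc n) * d z w < k b"
        using pos_less_divide_eq[of "of_nat (Suc n)" "d z w" "k b"]
        by (simp add: mult.commute del: of_nat_Suc)
    qed
    then have "w \<in> cls a z" using w(1) by (simp add: cls_def)
    then show ?thesis using cls_eq[OF z assms(2)] by simp
  qed
  then show "\<exists>r>0. \<forall>w\<in>topspace X. d z w < r \<longrightarrow> w \<in> cls a y" using e(1) by blast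
qed

lemma cls_nbhd_base:
  assumes "openin X U" "y \<in> U"
  obtains a where "a \<in> Field lam" "cls a y \<subseteq> U"
proof -
  obtain r where r: "r > 0" "\<And>z. z \<in> topspace X \<Longrightarrow> d y z < r \<Longrightarrow> z \<in> U"
    using assms unfolding openin_iff by blast
  obtain a where a: "a \<in> Field lam" "k a \<le> r" using k_coinitial[OF r(1)] by blast
  have "cls a y \<subseteq> U"
  proof
    fix z assume z: "z \<in> cls a y"
    then have "of_nat (Suc 0) * d y z < k a"
      using self_under[OF a(1)] unfolding cls_def near_def by blast
    then show "z \<in> U" using r(2) z a(2) by (auto simp: cls_def)
  qed
  then show ?thesis using that a(1) by blast
qed

text \<open>Classes need not be balls, while spherical completeness speaks of balls only. A point
  \<open>z\<close> of the larger class outside the smaller one provides the radius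
  \<open>d q z\<close>: some scale up to \<open>b\<close> fails at \<open>z\<close> but holds on the
  whole smaller class, and \<open>near_mono\<close> keeps the ball inside the larger class.\<close>

lemma cball_between:
  assumes "(a, b) \<in> lam" "p \<in> topspace X" "q \<in> topspace X" "cls b q \<subset> cls a p"
  shows "\<exists>c r. c \<in> topspace X \<and> 0 < r \<and>
    cls b q \<subseteq> G_cball (topspace X) d c r \<and> G_cball (topspace X) d c r \<subseteq> cls a p"
proof -
  obtain z where z: "z \<in> cls a p" "z \<notin> cls b q" using assms(4) by blast
  have zX: "z \<in> topspace X" using z(1) cls_subset by blast
  have "q \<in> cls a p" using cls_self[OF assms(3)] assms(4) by blast
  then have eq: "cls a q = cls a p" using cls_eq assms(2) by blast
  have "z \<noteq> q" using z(2) cls_self[OF assms(3)] by blast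
  then have pos: "0 < d q z" using d_nonneg[OF assms(3) zX] d_zero[OF assms(3) zX] by auto
  obtain g n where g: "g \<in> under lam b" "k g \<le> of_nat (Suc n) * d q z"
    using z(2) zX unfolding cls_def near_def by (auto simp: not_less simp del: of_nat_Suc)
  have "cls b q \<subseteq> G_cball (topspace X) d q (d q z)"
  proof
    fix w assume w: "w \<in> cls b q"
    then have "of_nat (Suc n) * d q w < k g" using g(1) unfolding cls_def near_def by blast
    then have "of_nat (Suc n) * d q w < of_nat (Suc n) * d q z" using g(2) by (rule less_le_trans)
    then have "d q w < d q z" by (rule mult_left_less_imp_less) (simp del: of_nat_Suc)
    then show "w \<in> G_cball (topspace X) d q (d q z)"
      using w by (auto simp: G_cball_def cls_def)
  qed
  moreover have "G_cball (topspace X) d q (d q z) \<subseteq> cls a p"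
    using z(1) near_mono unfolding eq[symmetric] by (auto simp: G_cball_def cls_def)
  ultimately show ?thesis using assms(3) pos by blast
qed

text \<open>If the chain has a smallest class, any point of it works. Otherwise a closed ball is
  interpolated between each class and the next smaller one, and spherical completeness is applied to
  these balls.\<close>

lemma chain_of_classes:
  assumes T: "T \<subseteq> Field lam" "T \<noteq> {}" and p: "\<And>a. a \<in> T \<Longrightarrow> p a \<in> topspace X"
    and anti: "\<And>a b. a \<in> T \<Longrightarrow> b \<in> T \<Longrightarrow> (a, b) \<in> lam \<Longrightarrow> cls b (p b) \<subseteq> cls a (p a)"
  shows "\<exists>y\<in>topspace X. \<forall>a\<in>T. y \<in> cls a (p a)"
proof (cases "\<exists>a\<in>T. \<forall>b\<in>T. cls a (p a) \<subseteq> cls b (p b)")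
  case True
  then show ?thesis using p cls_self by blast
next
  case False
  define P where "P a = cls a (p a)" for a
  \<comment> \<open>The distinct classes themselves index the balls, which removes repetitions;
    \<open>idx Q\<close> is the first scale at which the class \<open>Q\<close> occurs.\<close>
  define idx where "idx Q = L.minim {a \<in> T. P a = Q}" for Q
  have idx: "idx Q \<in> T" "P (idx Q) = Q" if "Q \<in> P ` T" for Q
    using L.minim_in[of "{a \<in> T. P a = Q}"] T(1) that unfolding idx_def by auto
  have idx_less: "idx Q \<in> underS lam b" if Q: "Q \<in> P ` T" "b \<in> T" "P b \<subset> Q" for Q b
  proof -
    have "(b, idx Q) \<notin> lam" using anti[of b "idx Q"] idx[OF Q(1)] Q unfolding P_def by blast
    then show ?thesis using wo_underS_iff[OF WO, of b "idx Q"] idx(1)[OF Q(1)] Q(2) T(1) by blast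
  qed
  \<comment> \<open>Larger classes come first, as a decreasing sequence of balls demands;
    well-foundedness is pulled back from \<open>lam\<close> along \<open>idx\<close>.\<close>
  define s where "s = {(Q, R). Q \<in> P ` T \<and> R \<in> P ` T \<and> R \<subseteq> Q}"
  have Field_s: "Field s = P ` T" unfolding s_def Field_def by blast
  have tot: "P a \<subseteq> P b \<or> P b \<subseteq> P a" if "a \<in> T" "b \<in> T" for a b
    using anti[of a b] anti[of b a] that T(1) L.TOTALS unfolding P_def by blast
  have "wf (s - Id)"
  proof (rule wf_subset[OF wf_inv_image[OF L.WF, of idx]])
    show "s - Id \<subseteq> inv_image (lam - Id) idx"
    proof (rule subrelI)
      fix Q R assume "(Q, R) \<in> s - Id"
      then have "Q \<in> P ` T" "R \<in> P ` T" "R \<subset> Q" unfolding s_def by auto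
      then have "idx Q \<in> underS lam (idx R)" using idx_less[of Q "idx R"] idx[of R] by simp
      then show "(Q, R) \<in> inv_image (lam - Id) idx" by (auto simp: underS_def)
    qed
  qed
  moreover have "Linear_order s"
    unfolding order_on_defs Field_s
    using tot by (auto simp: s_def refl_on_def trans_def antisym_def total_on_def)
  ultimately have WOs: "Well_order s" by (simp add: well_order_on_def)
  \<comment> \<open>The first scale \<open>b\<close> whose class is strictly inside \<open>Q\<close>
    carries the largest such class, so a ball between \<open>P b\<close> and \<open>Q\<close>
    contains every smaller class of the chain. This makes the balls nested.\<close>
  have "\<exists>c r. c \<in> topspace X \<and> 0 < r \<and> G_cball (topspace X) d c r \<subseteq> Q \<and>
      (\<forall>R\<in>P ` T. R \<subset> Q \<longrightarrow> R \<subseteq> G_cball (topspace X) d c r)" if Q: "Q \<in> P ` T" for Q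
  proof -
    define B where "B = {b \<in> T. P b \<subset> Q}"
    have "\<exists>b\<in>T. \<not> Q \<subseteq> P b" using False Q unfolding P_def by blast
    then have "B \<noteq> {}" using tot idx[OF Q] unfolding B_def by blast
    define b where "b = L.minim B"
    have BF: "B \<subseteq> Field lam" using T(1) unfolding B_def by blast
    have b: "b \<in> T" "P b \<subset> Q" using L.minim_in[OF BF \<open>B \<noteq> {}\<close>] unfolding b_def B_def by auto
    have "(idx Q, b) \<in> lam" using idx_less[OF Q b] by (auto simp: underS_def)
    then obtain c r where cr: "c \<in> topspace X" "0 < r" "P b \<subseteq> G_cball (topspace X) d c r"
      "G_cball (topspace X) d c r \<subseteq> Q"
      using cball_between[of "idx Q" b "p (idx Q)" "p b"] p idx[OF Q] b unfolding P_def by auto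
    moreover have "R \<subseteq> P b" if R: "R \<in> P ` T" "R \<subset> Q" for R
    proof -
      have "idx R \<in> B" using R idx[OF R(1)] unfolding B_def by auto
      then have "(b, idx R) \<in> lam" using L.minim_least[OF BF] unfolding b_def by blast
      then show ?thesis using anti[OF b(1) idx(1)[OF R(1)]] idx(2)[OF R(1)] unfolding P_def by blast
    qed
    ultimately show ?thesis by blast
  qed
  then obtain c r where cr: "\<And>Q. Q \<in> P ` T \<Longrightarrow> c Q \<in> topspace X \<and> 0 < r Q \<and>
      G_cball (topspace X) d (c Q) (r Q) \<subseteq> Q \<and>
      (\<forall>R\<in>P ` T. R \<subset> Q \<longrightarrow> R \<subseteq> G_cball (topspace X) d (c Q) (r Q))"
    by metis
  have "(\<Inter>Q\<in>Field s. G_cball (topspace X) d (c Q) (r Q)) \<noteq> {}"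
  proof (rule spherical[unfolded spherically_complete_metric_def, rule_format], intro conjI)
    show "Well_order s" by (rule WOs)
    show "Field s \<noteq> {}" using T(2) Field_s by simp
    show "\<forall>Q\<in>Field s. c Q \<in> topspace X \<and> 0 < r Q" using cr Field_s by simp
    show "\<forall>Q R. (Q, R) \<in> s \<longrightarrow>
        G_cball (topspace X) d (c R) (r R) \<subseteq> G_cball (topspace X) d (c Q) (r Q)"
    proof (intro allI impI)
      fix Q R assume "(Q, R) \<in> s"
      then have QR: "Q \<in> P ` T" "R \<in> P ` T" "R = Q \<or> R \<subset> Q" unfolding s_def by auto
      show "G_cball (topspace X) d (c R) (r R) \<subseteq> G_cball (topspace X) d (c Q) (r Q)"
      proof (cases "R = Q")
        case False
        then have "R \<subset> Q" using QR(3) by blast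
        then have "R \<subseteq> G_cball (topspace X) d (c Q) (r Q)" using cr[OF QR(1)] QR(2) by blast
        moreover have "G_cball (topspace X) d (c R) (r R) \<subseteq> R" using cr[OF QR(2)] by blast
        ultimately show ?thesis by (rule subset_trans[rotated])
      qed simp
    qed
  qed
  then obtain y where y: "\<And>Q. Q \<in> P ` T \<Longrightarrow> y \<in> G_cball (topspace X) d (c Q) (r Q)"
    unfolding Field_s by blast
  then have "y \<in> P a" if "a \<in> T" for a using cr[of "P a"] that by blast
  then show ?thesis using T(2) cls_subset unfolding P_def by blast
qed

text \<open>Here \<open>pt a\<close> is a guess for the class at scale \<open>a\<close>; guesses that contradict earlier ones are
  ignored.\<close>

lemma coherent_point:
  assumes pt: "\<And>a. a \<in> Field lam \<Longrightarrow> pt a \<in> topspace X" and B: "B \<subseteq> Field lam"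
    and ne: "topspace X \<noteq> {}"
  shows "\<exists>y\<in>topspace X. \<forall>a\<in>B. (\<exists>z. \<forall>b\<in>under lam a. z \<in> cls b (pt b)) \<longrightarrow> y \<in> cls a (pt a)"
proof -
  define T where "T = {a \<in> B. \<exists>z. \<forall>b\<in>under lam a. z \<in> cls b (pt b)}"
  have TF: "T \<subseteq> Field lam" using B unfolding T_def by blast
  show ?thesis
  proof (cases "T = {}")
    case True
    then show ?thesis using ne unfolding T_def by blast
  next
    case False
    \<comment> \<open>A common point of the guesses up to \<open>b\<close> lies in both classes, so
      each is the class of that point, and these shrink as the scale grows.\<close>
    have "cls b (pt b) \<subseteq> cls a (pt a)" if ab: "a \<in> T" "b \<in> T" "(a, b) \<in> lam" for a b
    proof -
      obtain z where z: "\<forall>c\<in>under lam b. z \<in> cls c (pt c)" using ab(2) unfolding T_def by blast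
      have "z \<in> cls b (pt b)" "z \<in> cls a (pt a)"
        using z self_under[of b] ab TF by (auto simp: under_def)
      then have "cls b z = cls b (pt b)" "cls a z = cls a (pt a)" using cls_eq pt ab TF by blast+
      then show ?thesis using cls_anti[OF ab(3)] by metis
    qed
    from chain_of_classes[of T pt, OF TF False _ this] pt TF show ?thesis unfolding T_def by blast
  qed
qed

end

subsection \<open>Ambiguous classes\<close>

context regular_cardinal
begin

text \<open>Only successor levels are admitted: there \<open>\<Sigma>\<^sup>0\<close> is closed under small intersections. If \<open>xi\<close> is
  a limit, all of them are automatically below \<open>xi\<close>.\<close>

definition adm :: "'l set \<Rightarrow> 'l set set" where
  "adm xi = {zeta. is_successor (cardSuc lam) zeta \<and> zeta \<sqsubseteq> xi}"

lemma is_successor_one: "is_successor (cardSuc lam) one"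
  unfolding is_successor_def oone_def using S.ozero_in by blast

lemma is_successor_ge_one: "is_successor (cardSuc lam) zeta \<Longrightarrow> one \<sqsubseteq> zeta"
  unfolding is_successor_def using S.oone_le_osuc by blast

end

context G_metric_space
begin

lemma Delta_compl: "Delta xi A \<Longrightarrow> Delta xi (topspace X - A)"
  unfolding Delta_def by (simp add: double_diff)

lemma Delta_empty: "Delta one {}"
  by (simp add: Delta_def Sigma0_one)

text \<open>A set whose complement has level \<open>eta\<close> below \<open>xi\<close> is ambiguous
  at the successor of \<open>eta\<close>, which does not exceed \<open>xi\<close>. At level
  \<open>one\<close> clopen sets play this part.\<close>

lemma Sigma0_union_Delta:
  assumes "Sig xi U"
  obtains \<F> where "moderate \<F>" "U = \<Union>\<F>" "\<And>A. A \<in> \<F> \<Longrightarrow> \<exists>zeta\<in>adm xi. Delta zeta A"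
proof (cases "xi = one")
  case True
  then have one: "one \<in> adm xi"
    using Sigma0_level[OF assms] is_successor_one by (simp add: adm_def)
  obtain \<C> where C: "moderate \<C>" "\<And>C. C \<in> \<C> \<Longrightarrow> clopen C" "\<Union>\<C> = U"
    using open_clopen_union assms True Sigma0_one by metis
  have "\<exists>zeta\<in>adm xi. Delta zeta C" if "C \<in> \<C>" for C
    using C(2)[OF that] one
    by (intro bexI[of _ one]) (auto simp: Delta_def clopen_def Sigma0_one dest: openin_subset)
  then show ?thesis using that[of \<C>] C(1,3) by blast
next
  case False
  then have gt: "one \<sqsubset> xi" using Sigma0_level[OF assms] by (auto simp: underS_def)
  obtain \<F> where F: "moderate \<F>" "U = \<Union>\<F>"
    "\<forall>A\<in>\<F>. A \<subseteq> topspace X \<and> (\<exists>eta. eta \<sqsubset> xi \<and> Sig eta (topspace X - A))"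
    using assms unfolding Sigma0_gt_one[OF gt] by (elim exE conjE) (rule that)
  have "\<exists>zeta\<in>adm xi. Delta zeta A" if A: "A \<in> \<F>" for A
  proof -
    obtain eta where eta: "eta \<sqsubset> xi" "Sig eta (topspace X - A)" and AX: "A \<subseteq> topspace X"
      using F(3) A by blast
    have etaF: "eta \<in> Field (cardSuc lam)" using eta(1) underS_Field by fast
    have lt: "eta \<sqsubset> osuc (cardSuc lam) eta" using S.less_osuc[OF etaF] .
    have "Delta (osuc (cardSuc lam) eta) A"
      unfolding Delta_def
    proof (intro conjI AX)
      show "Sig (osuc (cardSuc lam) eta) A" using Pi_imp_Sigma[OF eta(2) AX lt] .
      show "Sig (osuc (cardSuc lam) eta) (topspace X - A)"
        using Sigma0_mono[OF eta(2)] lt by (auto simp: underS_def)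
    qed
    moreover have "osuc (cardSuc lam) eta \<in> adm xi"
      unfolding adm_def is_successor_def using etaF S.osuc_le[OF eta(1)] by blast
    ultimately show ?thesis by blast
  qed
  then show ?thesis using that F by metis
qed

text \<open>De Morgan dual of \<open>Sigma0_union_Delta\<close>. The empty set is added to make the
  family enumerable; its complement is the whole space and leaves the intersection
  unchanged.\<close>

lemma Pi0_intersection_Delta:
  assumes "Sig xi (topspace X - A)" "A \<subseteq> topspace X"
  obtains D where "A = topspace X \<inter> (\<Inter>j\<in>Field lam. D j)"
    "\<And>j. \<exists>zeta\<in>adm xi. Delta zeta (D j)"
proof -
  obtain \<F> where F: "moderate \<F>" "topspace X - A = \<Union>\<F>"
    "\<And>B. B \<in> \<F> \<Longrightarrow> \<exists>zeta\<in>adm xi. Delta zeta B"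
    using Sigma0_union_Delta[OF assms(1)] by metis
  have "one \<in> adm xi" using Sigma0_level[OF assms(1)] is_successor_one by (simp add: adm_def)
  then have F': "\<exists>zeta\<in>adm xi. Delta zeta B" if "B \<in> insert {} \<F>" for B
    using that F(3) Delta_empty by blast
  obtain e where e: "\<And>i. e i \<in> insert {} \<F>" "e ` Field lam = insert {} \<F>"
    using moderate_enum[OF moderate_insert[OF F(1)] insert_not_empty] by metis
  show ?thesis
  proof
    have "\<Union>(e ` Field lam) = topspace X - A" using F(2) e(2) by simp
    then show "A = topspace X \<inter> (\<Inter>j\<in>Field lam. topspace X - e j)" using assms(2) by blast
    show "\<exists>zeta\<in>adm xi. Delta zeta (topspace X - e j)" for j
      using F'[OF e(1)[of j]] Delta_compl by blast
  qed
qed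

text \<open>The hypothesis on \<open>xi\<close> enters here. A successor \<open>xi\<close> is itself
  admissible; at a limit of cofinality \<open>lam\<close> fewer than \<open>lam\<close> levels are
  bounded by some \<open>b\<close> below \<open>xi\<close>, and the successor of \<open>b\<close> is
  admissible.\<close>

lemma common_level:
  assumes lev: "xi \<in> Field (cardSuc lam)" "is_successor (cardSuc lam) xi \<or>
         (is_limit (cardSuc lam) xi \<and> has_cofinality (cardSuc lam) xi lam)"
    and I: "small I" and D: "\<And>t. t \<in> I \<Longrightarrow> \<exists>zeta\<in>adm xi. Delta zeta (D t)"
  obtains zeta where "zeta \<in> adm xi" "\<And>t. t \<in> I \<Longrightarrow> Delta zeta (D t)"
proof (cases "is_successor (cardSuc lam) xi")
  case True
  then have "xi \<in> adm xi" using lev(1) S.REFL by (auto simp: adm_def refl_on_def)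
  moreover have "Delta xi (D t)" if "t \<in> I" for t
    using D[OF that] Delta_mono unfolding adm_def by blast
  ultimately show ?thesis using that by blast
next
  case False
  then have cof: "has_cofinality (cardSuc lam) xi lam" using lev(2) by blast
  obtain z where z: "\<And>t. t \<in> I \<Longrightarrow> z t \<in> adm xi \<and> Delta (z t) (D t)" using D by metis
  have zlt: "z t \<sqsubset> xi" if "t \<in> I" for t
    using z[OF that] False unfolding adm_def underS_def by blast
  have "small (z ` I)" using small_image[OF I] .
  then have "\<not> cofinal_below (cardSuc lam) xi (z ` I)"
    using cof not_ordLess_ordLeq unfolding has_cofinality_def by blast
  then obtain b where b: "b \<sqsubset> xi" "\<And>t. t \<in> I \<Longrightarrow> \<not> b \<sqsubseteq> z t"
    using zlt unfolding cofinal_below_def by blast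
  have bF: "b \<in> Field (cardSuc lam)" using b(1) underS_Field by fast
  show ?thesis
  proof
    show "osuc (cardSuc lam) b \<in> adm xi"
      unfolding adm_def is_successor_def using bF S.osuc_le[OF b(1)] by blast
    show "Delta (osuc (cardSuc lam) b) (D t)" if t: "t \<in> I" for t
    proof -
      have "z t \<in> Field (cardSuc lam)" using zlt[OF t] underS_Field by fast
      then have "z t \<sqsubset> b" using b(2)[OF t] S.le_or_less[OF bF] by blast
      then have "z t \<sqsubseteq> osuc (cardSuc lam) b"
        using S.less_osuc_iff[OF bF] by (auto simp: underS_def)
      then show ?thesis using z[OF t] Delta_mono by blast
    qed
  qed
qed

lemma meas_fun_mono:
  assumes "eta \<sqsubseteq> xi"
  shows "meas_fun lam X Y eta \<subseteq> meas_fun lam X Y xi"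
  using Sigma0_mono[OF _ assms] unfolding meas_fun_def by blast

end

lemma lam_lim_mono: "F \<subseteq> G \<Longrightarrow> lam_lim lam X Y F \<subseteq> lam_lim lam X Y G"
  unfolding lam_lim_def by blast

subsection \<open>Measurable functions as limits\<close>

locale measurable_limits = regular_cardinal lam +
  X: G_metric_space lam X dX + Y: spherical_space lam Y dY k
  for lam :: "'l rel" and X :: "'a topology" and dX :: "'a \<Rightarrow> 'a \<Rightarrow> 'g::linordered_field"
    and Y :: "'b topology" and dY :: "'b \<Rightarrow> 'b \<Rightarrow> 'g" and k :: "'l \<Rightarrow> 'g"
begin

section \<open>Pointwise limits are measurable one level up\<close>

lemma lam_lim_subset_meas_fun:
  assumes one: "one \<sqsubseteq> xi"
  shows "lam_lim lam X Y (meas_fun lam X Y xi) \<subseteq> meas_fun lam X Y (osuc (cardSuc lam) xi)"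
proof
  fix f assume "f \<in> lam_lim lam X Y (meas_fun lam X Y xi)"
  then obtain g where f: "f \<in> topspace X \<rightarrow>\<^sub>E topspace Y"
    and g: "\<And>a. a \<in> Field lam \<Longrightarrow> g a \<in> meas_fun lam X Y xi"
    and lim: "\<And>x. x \<in> topspace X \<Longrightarrow> limitin Y (\<lambda>a. g a x) (f x) (tails lam)"
    unfolding lam_lim_def by blast
  have gY: "g a x \<in> topspace Y" if "a \<in> Field lam" "x \<in> topspace X" for a x
    using g[OF that(1)] that(2) unfolding meas_fun_def by blast
  have xiF: "xi \<in> Field (cardSuc lam)" using one by (auto simp: Field_def)
  have clopen: "X.Sig (osuc (cardSuc lam) xi) {x \<in> topspace X. f x \<in> C}" if C: "Y.clopen C" for C
  proof -
    \<comment> \<open>\<open>A a\<close> collects the points whose approximants stay in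
      \<open>C\<close> from \<open>a\<close> on. Its complement is a union of at most
      \<open>lam\<close> preimages of an open set, so \<open>A a\<close> may be a constituent one
      level up.\<close>
    define A where "A a = {x \<in> topspace X. \<forall>b. (a, b) \<in> lam \<longrightarrow> g b x \<in> C}" for a
    have op: "openin Y C" "openin Y (topspace Y - C)" using C unfolding Y.clopen_def by auto
    have "X.Sig xi (topspace X - A a)" for a
    proof -
      have "X.Sig xi (\<Union>b\<in>{b. (a, b) \<in> lam}. {x \<in> topspace X. g b x \<in> topspace Y - C})"
      proof (rule X.Sigma0_Union[OF _ _ one])
        show "moderate {b. (a, b) \<in> lam}"
          by (rule moderate_mono[OF _ moderate_Field]) (auto simp: Field_def)
        show "X.Sig xi {x \<in> topspace X. g b x \<in> topspace Y - C}" if "b \<in> {b. (a, b) \<in> lam}" for b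
        proof -
          have "b \<in> Field lam" using that by (auto simp: Field_def)
          then show ?thesis using g[of b] op(2) unfolding meas_fun_def by blast
        qed
      qed
      moreover have "(\<Union>b\<in>{b. (a, b) \<in> lam}. {x \<in> topspace X. g b x \<in> topspace Y - C})
          = topspace X - A a"
        using gY by (auto simp: A_def Field_def)
      ultimately show ?thesis by simp
    qed
    then have "X.Sig (osuc (cardSuc lam) xi) (\<Union>(A ` Field lam))"
      unfolding X.Sigma0_succ[OF one]
      by (intro exI[of _ "A ` Field lam"]) (auto simp: moderate_image[OF moderate_Field] A_def)
    moreover have "\<Union>(A ` Field lam) = {x \<in> topspace X. f x \<in> C}"
    proof (intro equalityI subsetI)
      fix x assume "x \<in> \<Union>(A ` Field lam)"
      then obtain a where a: "a \<in> Field lam" "x \<in> topspace X" "\<forall>b. (a, b) \<in> lam \<longrightarrow> g b x \<in> C"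
        unfolding A_def by blast
      have "f x \<in> C"
      \<comment> \<open>Closedness of \<open>C\<close> is used: a limit outside \<open>C\<close>
        would eventually pull the values out of \<open>C\<close>.\<close>
      proof (rule ccontr)
        assume "f x \<notin> C"
        then have "f x \<in> topspace Y - C" using f a(2) by auto
        then have "eventually (\<lambda>b. g b x \<in> topspace Y - C) (tails lam)"
          using lim[OF a(2)] op(2) unfolding limitin_def by blast
        moreover have "eventually (\<lambda>b. g b x \<in> C) (tails lam)"
          unfolding eventually_tails using a by blast
        ultimately have "eventually (\<lambda>b. False) (tails lam)"
          by eventually_elim blast
        then show False unfolding eventually_tails using L.REFL by (auto simp: refl_on_def)
      qed
      then show "x \<in> {x \<in> topspace X. f x \<in> C}" using a(2) by blast
    next
      fix x assume x: "x \<in> {x \<in> topspace X. f x \<in> C}"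
      then have "eventually (\<lambda>b. g b x \<in> C) (tails lam)"
        using lim op(1) unfolding limitin_def by blast
      then show "x \<in> \<Union>(A ` Field lam)" unfolding eventually_tails A_def using x by blast
    qed
    ultimately show ?thesis by simp
  qed
  have "X.Sig (osuc (cardSuc lam) xi) {x \<in> topspace X. f x \<in> U}" if U: "openin Y U" for U
  proof -
    obtain \<C> where C: "moderate \<C>" "\<And>C. C \<in> \<C> \<Longrightarrow> Y.clopen C" "\<Union>\<C> = U"
      using Y.open_clopen_union[OF U] by metis
    have "X.Sig (osuc (cardSuc lam) xi) (\<Union>C\<in>\<C>. {x \<in> topspace X. f x \<in> C})"
      using C(1) clopen[OF C(2)] S.oone_le_osuc[OF xiF] by (rule X.Sigma0_Union)
    moreover have "(\<Union>C\<in>\<C>. {x \<in> topspace X. f x \<in> C}) = {x \<in> topspace X. f x \<in> U}"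
      using C(3) by blast
    ultimately show ?thesis by simp
  qed
  then show "f \<in> meas_fun lam X Y (osuc (cardSuc lam) xi)" using f unfolding meas_fun_def by blast
qed

text \<open>Data at scale \<open>a\<close> for the converse inclusion: for each \<open>c\<close> the
  intersection of the sets \<open>D c j\<close> is a piece of \<open>X\<close> on which
  \<open>f\<close> stays in the class of \<open>pt c\<close>. Keeping the index \<open>j\<close>
  visible means that leaving a piece is witnessed by a single \<open>D c j\<close>.\<close>

definition approximates ::
  "'l set \<Rightarrow> ('a \<Rightarrow> 'b) \<Rightarrow> 'l \<Rightarrow> ('l \<Rightarrow> 'b) \<Rightarrow> ('l \<Rightarrow> 'l \<Rightarrow> 'a set) \<Rightarrow> bool" where
  "approximates xi f a pt D \<longleftrightarrow> (\<forall>c. pt c \<in> topspace Y) \<and>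
    (\<forall>c. \<forall>x\<in>topspace X. (\<forall>j\<in>Field lam. x \<in> D c j) \<longrightarrow> f x \<in> Y.cls a (pt c)) \<and>
    (\<forall>x\<in>topspace X. \<exists>c\<in>Field lam. \<forall>j\<in>Field lam. x \<in> D c j) \<and>
    (\<forall>c j. \<exists>zeta\<in>adm xi. X.Delta zeta (D c j))"

text \<open>At most \<open>lam\<close> classes cover \<open>Y\<close>, and the preimage of each is a
  union of at most \<open>lam\<close> sets with complement of level \<open>xi\<close>. These are the
  pieces, and \<open>Pi0_intersection_Delta\<close> splits each of them.\<close>

lemma approximates_exist:
  assumes one: "one \<sqsubseteq> xi" and f: "f \<in> meas_fun lam X Y (osuc (cardSuc lam) xi)"
    and ne: "topspace X \<noteq> {}" and a: "a \<in> Field lam"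
  shows "\<exists>pt D. approximates xi f a pt D"
proof -
  have fY: "f x \<in> topspace Y" if "x \<in> topspace X" for x
    using f that unfolding meas_fun_def by blast
  obtain \<V> where V: "\<V> \<subseteq> Y.cls a ` topspace Y" "moderate \<V>" "\<Union>\<V> = \<Union>(Y.cls a ` topspace Y)"
    using Y.Lindelof[of "Y.cls a ` topspace Y"] Y.openin_cls[OF a] by blast
  have "\<forall>V\<in>\<V>. \<exists>\<F>. moderate \<F> \<and> {x \<in> topspace X. f x \<in> V} = \<Union>\<F> \<and>
      (\<forall>A\<in>\<F>. A \<subseteq> topspace X \<and> X.Sig xi (topspace X - A))" (is "\<forall>V\<in>\<V>. \<exists>\<F>. ?P V \<F>")
  proof
    fix V assume "V \<in> \<V>"
    then have "openin Y V" using V(1) Y.openin_cls[OF a] by blast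
    then have "X.Sig (osuc (cardSuc lam) xi) {x \<in> topspace X. f x \<in> V}"
      using f unfolding meas_fun_def by blast
    then show "\<exists>\<F>. ?P V \<F>" unfolding X.Sigma0_succ[OF one] .
  qed
  from bchoice[OF this] obtain F where "\<forall>V\<in>\<V>. ?P V (F V)" ..
  then have F: "\<And>V. V \<in> \<V> \<Longrightarrow> moderate (F V)"
    "\<And>V. V \<in> \<V> \<Longrightarrow> {x \<in> topspace X. f x \<in> V} = \<Union>(F V)"
    "\<And>V A. V \<in> \<V> \<Longrightarrow> A \<in> F V \<Longrightarrow> A \<subseteq> topspace X \<and> X.Sig xi (topspace X - A)"
    by simp_all
  define G where "G = (\<Union>V\<in>\<V>. F V)"
  have mG: "moderate G" unfolding G_def using V(2) F(1) by (rule moderate_UN)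
  have cover: "\<exists>A\<in>G. x \<in> A" if x: "x \<in> topspace X" for x
  proof -
    have "f x \<in> \<Union>\<V>" unfolding V(3) using fY[OF x] Y.cls_self by blast
    then obtain V' where "V' \<in> \<V>" "f x \<in> V'" by blast
    then show ?thesis unfolding G_def using F(2)[of V'] x by blast
  qed
  then have "G \<noteq> {}" using ne by blast
  with mG obtain e where e: "\<And>c. e c \<in> G" "e ` Field lam = G" using moderate_enum by metis
  have "\<exists>y. y \<in> topspace Y \<and> (\<forall>x\<in>e c. f x \<in> Y.cls a y)" for c
  proof -
    obtain V' where V': "V' \<in> \<V>" "e c \<in> F V'" using e(1)[of c] unfolding G_def by blast
    then obtain y where "y \<in> topspace Y" "V' = Y.cls a y" using V(1) by blast
    then show ?thesis using F(2)[OF V'(1)] V'(2) by blast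
  qed
  then obtain pt where pt: "\<And>c. pt c \<in> topspace Y" "\<And>c x. x \<in> e c \<Longrightarrow> f x \<in> Y.cls a (pt c)"
    by metis
  have "\<exists>D. e c = topspace X \<inter> (\<Inter>j\<in>Field lam. D j) \<and> (\<forall>j. \<exists>zeta\<in>adm xi. X.Delta zeta (D j))" for c
  proof -
    obtain V' where V': "V' \<in> \<V>" "e c \<in> F V'" using e(1)[of c] unfolding G_def by blast
    then have "e c \<subseteq> topspace X" "X.Sig xi (topspace X - e c)" using F(3) by blast+
    then show ?thesis using X.Pi0_intersection_Delta by metis
  qed
  then obtain D where D: "\<And>c. e c = topspace X \<inter> (\<Inter>j\<in>Field lam. D c j)"
    "\<And>c j. \<exists>zeta\<in>adm xi. X.Delta zeta (D c j)" by metis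
  have "\<exists>c\<in>Field lam. \<forall>j\<in>Field lam. x \<in> D c j" if x: "x \<in> topspace X" for x
  proof -
    obtain c where "c \<in> Field lam" "x \<in> e c" using cover[OF x] unfolding e(2)[symmetric] by blast
    then show ?thesis using D(1)[of c] by blast
  qed
  moreover have "f x \<in> Y.cls a (pt c)" if "x \<in> topspace X" "\<forall>j\<in>Field lam. x \<in> D c j" for c x
    using pt(2)[of x c] that unfolding D(1)[of c] by blast
  ultimately have "approximates xi f a pt D" using pt(1) D(2) unfolding approximates_def by blast
  then show ?thesis by blast
qed

text \<open>Levels in \<open>adm xi\<close> are at most \<open>xi\<close>, and strictly below it
  when \<open>xi\<close> is a limit, so this one statement gives the harder inclusion of both
  equalities.\<close>

lemma meas_fun_approximation:
  assumes one: "one \<sqsubseteq> xi" and f: "f \<in> meas_fun lam X Y (osuc (cardSuc lam) xi)"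
    and lev: "is_successor (cardSuc lam) xi \<or>
         (is_limit (cardSuc lam) xi \<and> has_cofinality (cardSuc lam) xi lam)"
  shows "f \<in> lam_lim lam X Y (\<Union>zeta\<in>adm xi. meas_fun lam X Y zeta)"
proof (cases "topspace X = {}")
  \<comment> \<open>For empty \<open>X\<close> there are no pieces to enumerate; \<open>f\<close> is
    measurable at level \<open>one\<close> and forms a constant sequence.\<close>
  case True
  have f': "f \<in> topspace X \<rightarrow>\<^sub>E topspace Y" using f unfolding meas_fun_def by blast
  have "X.Sig one {x \<in> topspace X. f x \<in> U}" for U
  proof -
    have eq: "{x \<in> topspace X. f x \<in> U} = {}" using True by blast
    show ?thesis unfolding eq by (simp add: X.Sigma0_one)
  qed
  then have "f \<in> meas_fun lam X Y one" unfolding meas_fun_def using f' by blast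
  moreover have "one \<in> adm xi" using one is_successor_one by (simp add: adm_def)
  ultimately show ?thesis
    unfolding lam_lim_def using True f' by (auto intro!: exI[of _ "\<lambda>_. f"])
next
  case False
  have fPi: "f \<in> topspace X \<rightarrow>\<^sub>E topspace Y" using f unfolding meas_fun_def by blast
  then have neY: "topspace Y \<noteq> {}" using False by (metis PiE_mem all_not_in_conv)
  have xiF: "xi \<in> Field (cardSuc lam)" using one by (auto simp: Field_def)
  obtain pt D where ptD: "\<And>a. a \<in> Field lam \<Longrightarrow> approximates xi f a (pt a) (D a)"
    using approximates_exist[OF one f False] by metis
  have pt: "pt a c \<in> topspace Y"
    and D: "\<exists>zeta\<in>adm xi. X.Delta zeta (D a c j)" if "a \<in> Field lam" for a c j
    using ptD[OF that] unfolding approximates_def by blast+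
  have f_cls: "f x \<in> Y.cls a (pt a c)"
    if "a \<in> Field lam" "x \<in> topspace X" "\<forall>j\<in>Field lam. x \<in> D a c j" for a c x
    using ptD[OF that(1)] that(2,3) unfolding approximates_def by blast
  have cover: "\<exists>c\<in>Field lam. \<forall>j\<in>Field lam. x \<in> D a c j"
    if "a \<in> Field lam" "x \<in> topspace X" for a x
    using ptD[OF that(1)] that(2) unfolding approximates_def by blast
  \<comment> \<open>The \<open>b\<close>-th approximation reads only the memberships \<open>x \<in> D a c j\<close> with \<open>a, c, j < b\<close>. At scale
    \<open>a\<close> it bets on the least \<open>c < b\<close> not yet refuted; \<open>minim\<close> of the empty set is junk, which is
    harmless because each guess is eventually correct.\<close>
  define I where "I b = underS lam b \<times> underS lam b \<times> underS lam b" for b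
  define D3 where "D3 t = D (fst t) (fst (snd t)) (snd (snd t))" for t
  define sig where "sig b x = {t \<in> I b. x \<in> D3 t}" for b x
  define guess where
    "guess b S a = L.minim {c \<in> underS lam b. \<forall>j\<in>underS lam b. (a, c, j) \<in> S}"
    for b S and a :: 'l
  define sel where "sel b S = (SOME y. y \<in> topspace Y \<and> (\<forall>a\<in>underS lam b.
      (\<exists>z. \<forall>a'\<in>under lam a. z \<in> Y.cls a' (pt a' (guess b S a'))) \<longrightarrow>
      y \<in> Y.cls a (pt a (guess b S a))))" for b S
  \<comment> \<open>By \<open>coherent_point\<close> a suitable value exists for every
    \<open>S\<close>, even one that is the signature of no point; \<open>sel\<close> can thus be a
    function of the signature alone.\<close>
  have sel: "sel b S \<in> topspace Y \<and> (\<forall>a\<in>underS lam b.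
      (\<exists>z. \<forall>a'\<in>under lam a. z \<in> Y.cls a' (pt a' (guess b S a'))) \<longrightarrow>
      sel b S \<in> Y.cls a (pt a (guess b S a)))" for b S
  proof -
    have "underS lam b \<subseteq> Field lam" using underS_Field by fast
    from Y.coherent_point[of "\<lambda>a. pt a (guess b S a)", OF pt this neY] show ?thesis
      unfolding sel_def Bex_def by (rule someI_ex)
  qed
  define g where "g b = (\<lambda>x\<in>topspace X. sel b (sig b x))" for b
  \<comment> \<open>Stage \<open>b\<close> reads fewer than \<open>lam\<close> sets, so
    \<open>common_level\<close> gives them one level, at which \<open>signature_preimage\<close>
    applies.\<close>
  have gM: "g b \<in> (\<Union>zeta\<in>adm xi. meas_fun lam X Y zeta)" if b: "b \<in> Field lam" for b
  proof -
    have smI: "small (I b)" unfolding I_def by (intro small_Sigma small_underS b)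
    have "\<exists>zeta\<in>adm xi. X.Delta zeta (D3 t)" if "t \<in> I b" for t
      using D that unfolding D3_def I_def by (auto dest: underS_Field)
    then obtain zeta where z: "zeta \<in> adm xi" "\<And>t. t \<in> I b \<Longrightarrow> X.Delta zeta (D3 t)"
      using X.common_level[OF xiF lev smI] by metis
    have "X.Sig zeta {x \<in> topspace X. g b x \<in> U}" for U
    proof -
      have "is_successor (cardSuc lam) zeta" using z(1) by (simp add: adm_def)
      from X.signature_preimage[OF this smI z(2), of "\<lambda>t. t" "\<lambda>S. sel b S \<in> U"]
      have "X.Sig zeta {x \<in> topspace X. sel b (sig b x) \<in> U}" by (simp add: sig_def)
      moreover have "{x \<in> topspace X. g b x \<in> U} = {x \<in> topspace X. sel b (sig b x) \<in> U}"
        by (auto simp: g_def)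
      ultimately show ?thesis by simp
    qed
    moreover have "g b \<in> topspace X \<rightarrow>\<^sub>E topspace Y" unfolding g_def using sel by auto
    ultimately show ?thesis using z(1) unfolding meas_fun_def by blast
  qed
  have guess_correct: "\<exists>c\<in>Field lam. \<forall>b. (c, b) \<in> lam \<longrightarrow> a \<in> underS lam b \<and>
      Y.cls a (pt a (guess b (sig b x) a)) = Y.cls a (f x)"
    if a: "a \<in> Field lam" and x: "x \<in> topspace X" for a x
  proof -
    define C where "C = {c \<in> Field lam. \<forall>j\<in>Field lam. x \<in> D a c j}"
    \<comment> \<open>The first piece that truly contains \<open>x\<close> is the guess that should
      stabilise.\<close>
    define c where "c = L.minim C"
    have CF: "C \<subseteq> Field lam" unfolding C_def by blast
    moreover have "C \<noteq> {}" using cover[OF a x] unfolding C_def by blast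
    ultimately have "c \<in> C" unfolding c_def by (rule L.minim_in)
    then have c: "c \<in> Field lam" "\<forall>j\<in>Field lam. x \<in> D a c j" unfolding C_def by auto
    have "\<exists>j. j \<in> Field lam \<and> x \<notin> D a c' j" if c': "c' \<in> underS lam c" for c'
    proof -
      have c'F: "c' \<in> Field lam" using c' underS_Field by fast
      have "c' \<notin> C" using L.minim_least[OF CF, of c'] c' wo_underS_iff[OF WO c(1) c'F]
        unfolding c_def by blast
      then show ?thesis using c'F unfolding C_def by blast
    qed
    then obtain jj where jj: "\<And>c'. c' \<in> underS lam c \<Longrightarrow> jj c' \<in> Field lam \<and> x \<notin> D a c' (jj c')"
      by metis
    \<comment> \<open>Beyond a bound of \<open>W\<close> scale \<open>a\<close> is in view,
      \<open>c\<close> is a candidate, and every smaller index has been refuted by its witness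
      \<open>jj\<close>.\<close>
    define W where "W = insert a (insert c (jj ` underS lam c))"
    have "small W" unfolding W_def by (intro small_insert small_image small_underS c)
    moreover have "W \<subseteq> Field lam" unfolding W_def using a c(1) jj by blast
    ultimately obtain w where w: "w \<in> Field lam" "W \<subseteq> underS lam w" using small_bounded by metis
    have "a \<in> underS lam b \<and> Y.cls a (pt a (guess b (sig b x) a)) = Y.cls a (f x)"
      if b: "(w, b) \<in> lam" for b
    proof -
      have Wb: "W \<subseteq> underS lam b" using w(2) wo_underS_under_trans[OF WO _ b] by blast
      define G where "G = {c \<in> underS lam b. \<forall>j\<in>underS lam b. (a, c, j) \<in> sig b x}"
      have ab: "a \<in> underS lam b" and cb: "c \<in> underS lam b" using Wb unfolding W_def by auto
      have sub: "underS lam b \<subseteq> Field lam" using underS_Field by fast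
      have mem: "(a, c', j) \<in> sig b x \<longleftrightarrow> x \<in> D a c' j"
        if "c' \<in> underS lam b" "j \<in> underS lam b" for c' j
        using that ab unfolding sig_def I_def D3_def by simp
      have "c = L.minim G"
      proof (rule L.equals_minim)
        show "G \<subseteq> Field lam" using sub unfolding G_def by blast
        show "c \<in> G" using c(2) cb mem sub unfolding G_def by blast
        fix c' assume c': "c' \<in> G"
        show "(c, c') \<in> lam"
        proof (rule ccontr)
          assume "(c, c') \<notin> lam"
          then have lt: "c' \<in> underS lam c"
            using wo_underS_iff[OF WO c(1)] c' sub unfolding G_def by blast
          then have "jj c' \<in> underS lam b" using Wb unfolding W_def by blast
          then have "x \<in> D a c' (jj c')" using c' mem unfolding G_def by blast
          then show False using jj[OF lt] by blast
        qed
      qed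
      then have "guess b (sig b x) a = c" unfolding guess_def G_def by simp
      then show ?thesis using Y.cls_eq[OF f_cls[OF a x c(2)] pt[OF a]] ab by simp
    qed
    then show ?thesis using w(1) by blast
  qed
  have "limitin Y (\<lambda>b. g b x) (f x) (tails lam)" if x: "x \<in> topspace X" for x
    unfolding limitin_def
  proof (intro conjI allI impI)
    show "f x \<in> topspace Y" using fPi x by blast
    fix U assume "openin Y U \<and> f x \<in> U"
    then obtain a where a: "a \<in> Field lam" "Y.cls a (f x) \<subseteq> U" using Y.cls_nbhd_base by metis
    \<comment> \<open>All scales up to \<open>a\<close> must be guessed correctly at once:
      \<open>f x\<close> is then a common point of the guessed classes, the consistency that
      \<open>sel\<close> asks for. Regularity bounds the thresholds \<open>cc\<close>.\<close>
    obtain cc where cc: "\<And>a'. a' \<in> under lam a \<Longrightarrow> cc a' \<in> Field lam"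
      "\<And>a' b. a' \<in> under lam a \<Longrightarrow> (cc a', b) \<in> lam \<Longrightarrow> a' \<in> underS lam b \<and>
        Y.cls a' (pt a' (guess b (sig b x) a')) = Y.cls a' (f x)"
      using guess_correct[OF Y.under_in_Field x] by metis
    obtain w where w: "w \<in> Field lam" "cc ` under lam a \<subseteq> underS lam w"
      using small_bounded[OF image_subsetI small_image[OF small_under[OF a(1)]], of cc] cc(1) by metis
    have "g b x \<in> U" if b: "(w, b) \<in> lam" for b
    proof -
      have le: "(cc a', b) \<in> lam" if "a' \<in> under lam a" for a'
        using wo_underS_under_trans[OF WO _ b] w(2) that by (auto simp: underS_def)
      have "\<forall>a'\<in>under lam a. f x \<in> Y.cls a' (pt a' (guess b (sig b x) a'))"
        using cc(2)[OF _ le] Y.cls_self[OF \<open>f x \<in> topspace Y\<close>] by blast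
      moreover have aa: "a \<in> under lam a" using Y.self_under[OF a(1)] .
      ultimately have "sel b (sig b x) \<in> Y.cls a (pt a (guess b (sig b x) a))"
        using sel[of b "sig b x"] cc(2)[OF aa le[OF aa]] by blast
      then have "sel b (sig b x) \<in> U" using cc(2)[OF aa le[OF aa]] a(2) by blast
      then show ?thesis using x by (simp add: g_def)
    qed
    then show "eventually (\<lambda>b. g b x \<in> U) (tails lam)" unfolding eventually_tails using w(1) by blast
  qed
  then show ?thesis unfolding lam_lim_def using fPi gM by blast
qed

end

theorem theorem6p3:
  fixes lam :: "'l rel" and X :: "'a topology" and Y :: "'b topology" and xi :: "'l set"
  assumes "Card_order lam" and "natLeq <o lam" and "two_lt lam =o lam"
    and "regularCard lam"
    and "has_coinitiality TYPE('g::linordered_field) lam"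
    and "M_class TYPE('g) lam X" and "M_class TYPE('g) lam Y"
    and "spherically_complete TYPE('g) Y"
    and "xi \<in> Field (cardSuc lam)" and "(oone (cardSuc lam), xi) \<in> cardSuc lam"
    and "is_successor (cardSuc lam) xi \<or>
         (is_limit (cardSuc lam) xi \<and> has_cofinality (cardSuc lam) xi lam)"
  shows "meas_fun lam X Y (osuc (cardSuc lam) xi) = lam_lim lam X Y (meas_fun lam X Y xi) \<and>
         (is_limit (cardSuc lam) xi \<longrightarrow>
          meas_fun lam X Y (osuc (cardSuc lam) xi) = lam_lim lam X Y (meas_fun_lt lam X Y xi))"
proof -
  interpret regular_cardinal lam using assms(1-4) by unfold_locales
  obtain dX :: "'a \<Rightarrow> 'a \<Rightarrow> 'g" where dX: "compatible_G_metric X dX"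
    using assms(6) unfolding M_class_def by blast
  obtain dY :: "'b \<Rightarrow> 'b \<Rightarrow> 'g" where dY: "compatible_G_metric Y dY"
    "spherically_complete_metric (topspace Y) dY"
    using assms(8) unfolding spherically_complete_def by blast
  obtain K :: "'g set" where K: "positive_coinitial K" "|K| =o lam"
    using assms(5) unfolding has_coinitiality_def by blast
  have "moderate K" using K(2) ordIso_iff_ordLeq by blast
  moreover have "K \<noteq> {}" using K(1) zero_less_one unfolding positive_coinitial_def by blast
  ultimately obtain k where k: "\<And>a. k a \<in> K" "k ` Field lam = K" using moderate_enum by metis
  interpret measurable_limits lam X dX Y dY k
  proof unfold_locales
    show "weight_le X lam" "weight_le Y lam" using assms(6,7) unfolding M_class_def by auto
    show "0 < k a" for a using k(1)[of a] K(1) unfolding positive_coinitial_def by auto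
    show "\<exists>a\<in>Field lam. k a \<le> e" if "0 < e" for e
      using K(1) that unfolding positive_coinitial_def k(2)[symmetric] by blast
  qed (fact assms(5) dX dY)+
  \<comment> \<open>\<open>?L\<close> is contained in either class of approximants, for limit
    \<open>xi\<close> because an admissible level, being a successor, differs from
    \<open>xi\<close>. Both equalities follow by monotonicity of \<open>lam_lim\<close>.\<close>
  let ?L = "\<Union>zeta\<in>adm xi. meas_fun lam X Y zeta"
  have sub: "meas_fun lam X Y (osuc (cardSuc lam) xi) \<subseteq> lam_lim lam X Y ?L"
    using meas_fun_approximation[OF assms(10) _ assms(11)] by blast
  have sup: "lam_lim lam X Y (meas_fun lam X Y xi) \<subseteq> meas_fun lam X Y (osuc (cardSuc lam) xi)"
    using lam_lim_subset_meas_fun[OF assms(10)] .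
  have L: "?L \<subseteq> meas_fun lam X Y xi"
    unfolding adm_def using X.meas_fun_mono by blast
  have lt: "meas_fun_lt lam X Y xi \<subseteq> meas_fun lam X Y xi"
    unfolding meas_fun_lt_def underS_def using X.meas_fun_mono by blast
  have L': "?L \<subseteq> meas_fun_lt lam X Y xi" if "is_limit (cardSuc lam) xi"
  proof -
    have "zeta \<sqsubset> xi \<and> one \<sqsubseteq> zeta" if "zeta \<in> adm xi" for zeta
      using that \<open>is_limit (cardSuc lam) xi\<close> is_successor_ge_one
      unfolding adm_def is_limit_def underS_def by blast
    then show ?thesis unfolding meas_fun_lt_def by blast
  qed
  show ?thesis
  proof (intro conjI impI equalityI)
    show "lam_lim lam X Y (meas_fun lam X Y xi) \<subseteq> meas_fun lam X Y (osuc (cardSuc lam) xi)"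
      by (rule sup)
    show "meas_fun lam X Y (osuc (cardSuc lam) xi) \<subseteq> lam_lim lam X Y (meas_fun lam X Y xi)"
      by (rule subset_trans[OF sub lam_lim_mono[OF L]])
    show "lam_lim lam X Y (meas_fun_lt lam X Y xi) \<subseteq> meas_fun lam X Y (osuc (cardSuc lam) xi)"
      by (rule subset_trans[OF lam_lim_mono[OF lt] sup])
    show "meas_fun lam X Y (osuc (cardSuc lam) xi) \<subseteq> lam_lim lam X Y (meas_fun_lt lam X Y xi)"
      if "is_limit (cardSuc lam) xi"
      by (rule subset_trans[OF sub lam_lim_mono[OF L'[OF that]]])
  qed
qed

end
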